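(* Let $\varphi$ be an increasing concave function on $[0,1]$ with $\varphi(0)=0$ and $\gamma_\varphi>0$, let $1\le p<\infty$, and let $w$ be a non-trivial weight on $[0,1]$ with associated sequence $(w_r)_{r\ge1}$ (defined in the context). Then the Lorentz space $\Lambda_{p,\varphi}$ is $w$-decomposable if and only if there exists $C>0$ such that for every sequence of reals $(\tau_r)_{r=1}^\infty$ with $0<\tau_r\le w_r$ ($r\in\mathbb N$), $$C^{-1}\varphi\Big(\sum_{r=1}^\infty\tau_r\Big)\le\Big(\sum_{r=1}^\infty\varphi(\tau_r)^p\Big)^{1/p}\le C\,\varphi\Big(\sum_{r=1}^\infty\tau_r\Big).$$
   Context: $m$ is Lebesgue measure; functions are identified if they agree a.e., and $\operatorname{supp}x$ and infima/suprema of $w$ over sets are understood up to null sets. For measurable $x$ on $[0,1]$, $x^*(t)=\inf\{\lambda>0: m\{|x|>\lambda\}\le t\}$. The Lorentz space $\Lambda_{p,\varphi}$ consists of measurable $x$ on $[0,1]$ with $\|x\|_{\Lambda_{p,\varphi}}=\Big(\int_0^1[x^*(t)\varphi(t)]^p\,\frac{dt}{t}\Big)^{1/p}<\infty$ (when $0<\gamma_\varphi\le\delta_\varphi<1$ this functional is equivalent to a norm making it a symmetric space; $w$-decomposability below is understood with respect to this functional, and is insensitive to passing to an equivalent one). Dilation indices: $\gamma_\varphi=\lim_{t\to0^+}\frac{\ln\bar\varphi(t)}{\ln t}$, $\delta_\varphi=\lim_{t\to\infty}\frac{\ln\bar\varphi(t)}{\ln t}$, where $\bar\varphi(t)=\sup\{\varphi(st)/\varphi(s):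 s,st\in(0,1]\}$. A weight on $[0,1]$ is a measurable function that is positive and finite a.e.; it is non-trivial if $w$ or $1/w$ is unbounded. For the weight $w$ put $M_k=\{t\in[0,1]: w(t)\in[2^k,2^{k+1})\}$, $k\in\mathbb Z$; $(w_r)_{r=1}^\infty$ is the non-increasing rearrangement of $(m(M_k))_{k\in\mathbb Z}$ (all $w_r>0$ because $w$ is non-trivial). A space $X$ of functions is $w$-decomposable if there is $C>0$ such that for every $n\in\mathbb N$ and all nonzero $x_1,\dots,x_n,y_1,\dots,y_n\in X$ with $\|x_i\|_X=\|y_i\|_X$ ($1\le i\le n$) and $\inf w(\operatorname{supp}x_i\cup\operatorname{supp}y_i)\ge 2\sup w(\operatorname{supp}x_{i+1}\cup\operatorname{supp}y_{i+1})$ ($1\le i\le n-1$), one has $C^{-1}\|\sum_{i=1}^n x_i\|_X\le\|\sum_{i=1}^n y_i\|_X\le C\|\sum_{i=1}^n x_i\|_X$. *)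

theory Defs
  imports "HOL-Analysis.Analysis" "HOL-Probability.Essential_Supremum"
begin

abbreviation unit_leb :: "real measure" where
  "unit_leb \<equiv> lebesgue_on {0..1}"

definition dilation_fun :: "(real \<Rightarrow> real) \<Rightarrow> real \<Rightarrow> real" where
  "dilation_fun \<phi> t = Sup {\<phi> (s * t) / \<phi> s | s. s \<in> {0<..1} \<and> s * t \<in> {0<..1}}"

definition lower_dilation_index :: "(real \<Rightarrow> real) \<Rightarrow> real" where
  "lower_dilation_index \<phi> = Lim (at_right 0) (\<lambda>t. ln (dilation_fun \<phi> t) / ln t)"

(* For t > 0 and measurable x the infimum is over a nonempty set; the value at t = 0, where
   the set may be empty, is never relevant since it is only used under an integral. *)
definition decr_rearr :: "(real \<Rightarrow> real) \<Rightarrow> real \<Rightarrow> real" where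
  "decr_rearr x t = Inf {c. c > 0 \<and> measure unit_leb {s \<in> {0..1}. \<bar>x s\<bar> > c} \<le> t}"

definition lorentz_modular :: "real \<Rightarrow> (real \<Rightarrow> real) \<Rightarrow> (real \<Rightarrow> real) \<Rightarrow> ennreal" where
  "lorentz_modular p \<phi> x =
     (\<integral>\<^sup>+ t. ennreal ((decr_rearr x t * \<phi> t) powr p / t) \<partial>unit_leb)"

definition lorentz_space :: "real \<Rightarrow> (real \<Rightarrow> real) \<Rightarrow> (real \<Rightarrow> real) set" where
  "lorentz_space p \<phi> = {x. x \<in> borel_measurable unit_leb \<and> lorentz_modular p \<phi> x < \<infinity>}"

definition lorentz_norm :: "real \<Rightarrow> (real \<Rightarrow> real) \<Rightarrow> (real \<Rightarrow> real) \<Rightarrow> real" where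
  "lorentz_norm p \<phi> x = enn2real (lorentz_modular p \<phi> x) powr (1 / p)"

definition weight :: "(real \<Rightarrow> real) \<Rightarrow> bool" where
  "weight w \<longleftrightarrow> w \<in> borel_measurable unit_leb \<and> (AE t in unit_leb. w t > 0)"

definition nontrivial_weight :: "(real \<Rightarrow> real) \<Rightarrow> bool" where
  "nontrivial_weight w \<longleftrightarrow> weight w \<and>
     ((\<nexists>K. AE t in unit_leb. w t \<le> K) \<or> (\<nexists>K. AE t in unit_leb. 1 / w t \<le> K))"

definition dyadic_level :: "(real \<Rightarrow> real) \<Rightarrow> int \<Rightarrow> real set" where
  "dyadic_level w k = {t \<in> {0..1}. 2 powi k \<le> w t \<and> w t < 2 powi (k + 1)}"

(* Non-increasing rearrangement of a nonnegative family tending to 0, indexed from 0: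
   the value at r is the (r + 1)-st largest term, counted with multiplicity. *)
definition family_rearr :: "('i \<Rightarrow> real) \<Rightarrow> nat \<Rightarrow> real" where
  "family_rearr a r = Inf {c. c \<ge> 0 \<and> finite {k. a k > c} \<and> card {k. a k > c} \<le> r}"

(* weight_seq w r is the term with 1-based index r + 1. *)
definition weight_seq :: "(real \<Rightarrow> real) \<Rightarrow> nat \<Rightarrow> real" where
  "weight_seq w = family_rearr (\<lambda>k. measure unit_leb (dyadic_level w k))"

definition essinf :: "'a measure \<Rightarrow> ('a \<Rightarrow> ereal) \<Rightarrow> ereal" where
  "essinf M f = Sup {z. AE t in M. z \<le> f t}"

definition supp :: "(real \<Rightarrow> real) \<Rightarrow> real set" where
  "supp x = {t \<in> {0..1}. x t \<noteq> 0}"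

(* X is the set of functions of the space and N its (quasi-)norm. *)
definition w_decomposable ::
  "(real \<Rightarrow> real) \<Rightarrow> (real \<Rightarrow> real) set \<Rightarrow> ((real \<Rightarrow> real) \<Rightarrow> real) \<Rightarrow> bool" where
  "w_decomposable w X N \<longleftrightarrow>
     (\<exists>C>0. \<forall>n\<ge>1. \<forall>x y :: nat \<Rightarrow> real \<Rightarrow> real.
        (\<forall>i\<in>{1..n}. x i \<in> X \<and> y i \<in> X \<and>
           \<not> (AE t in unit_leb. x i t = 0) \<and> \<not> (AE t in unit_leb. y i t = 0) \<and>
           N (x i) = N (y i)) \<longrightarrow>
        (\<forall>i\<in>{1..<n}.
           essinf (lebesgue_on (supp (x i) \<union> supp (y i))) (\<lambda>t. ereal (w t))
             \<ge> 2 * esssup (lebesgue_on (supp (x (i + 1)) \<union> supp (y (i + 1)))) (\<lambda>t. ereal (w t))) \<longrightarrow>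
        inverse C * N (\<lambda>t. \<Sum>i=1..n. x i t) \<le> N (\<lambda>t. \<Sum>i=1..n. y i t) \<and>
        N (\<lambda>t. \<Sum>i=1..n. y i t) \<le> C * N (\<lambda>t. \<Sum>i=1..n. x i t))"

end

theory Submission
  imports Defs
begin

text \<open>Write \<open>g = \<phi>\<^sup>p\<close> and let \<open>d\<^sub>x\<close> be the distribution function of \<open>x\<close>. Positivity of the lower
  dilation index gives \<open>g (\<rho> s) \<le> g s / 2\<close> for some \<open>\<rho>\<close>, so \<open>\<integral>\<^sub>0\<^sup>s g(t) dt/t\<close> is comparable to
  \<open>g s\<close>, and by the layer-cake formula \<open>\<parallel>x\<parallel>\<^sup>p\<close> is comparable to \<open>\<integral> p c\<^sup>p\<^sup>-\<^sup>1 g (d\<^sub>x c) dc\<close>.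
  Hence pointwise comparisons of \<open>g (d\<^sub>x c)\<close> turn into norm comparisons.

  If the sequence condition holds, then every dyadic level of \<open>w\<close> meets at most one of the supports
  of separated \<open>x\<^sub>i\<close>; cutting \<open>{|x\<^sub>i| > c}\<close> along the levels and applying the condition twice shows
  that \<open>\<parallel>\<Sum> x\<^sub>i\<parallel>\<^sup>p\<close> is comparable to \<open>\<Sum> \<parallel>x\<^sub>i\<parallel>\<^sup>p\<close>. Conversely, inside dyadic levels of equal parity compare
  indicators of sets of measure \<open>\<tau>\<^sub>r\<close> with multiples, of equal norm, of indicators of sets of
  geometrically decreasing measure: for the latter the \<open>p\<close>-th power of the norm is additive up to
  constants, which yields the sequence condition.\<close>

section \<open>Doubling functions with geometric decay\<close>

text \<open>Norms are compared height by height. The weight \<open>layer_density\<close> is the same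
  for every function, so an estimate between two finite sums of values
  \<open>g (distr_fun (x i) c)\<close>, valid at each height \<open>c\<close>, integrates to one
  between sums of modulars, at the cost of a fixed constant. The sequence condition is needed twice
  because the measures of the pieces form a matrix indexed by functions and levels: one application
  adds up each row, the other adds up the column sums, and a column has at most one nonzero entry.
  The condition speaks only of infinite positive sequences, so a finite family must first be
  completed by a negligible tail. In the converse, equality of norms dictates the coefficients of
  the comparison family. Geometrically decreasing measures make them harmless: a superlevel set of
  the sum is always a union of some of the small sets, and the largest of these governs both its
  measure and the value of \<open>g\<close>. Doubling absorbs the remaining losses:
  \<open>family_rearr\<close> is an infimum, so levels are found only for values strictly below it,
  and even and odd levels are treated separately.\<close>

lemma sum_half_powers_le:
  fixes I :: "nat set"
  assumes "finite I" "\<And>i. i \<in> I \<Longrightarrow> m \<le> i"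
  shows "(\<Sum>i\<in>I. (1/2::real) ^ (i - m)) \<le> 2"
proof -
  have "(\<Sum>i\<in>I. (1/2::real) ^ (i - m)) = (\<Sum>j\<in>(\<lambda>i. i - m) ` I. (1/2) ^ j)"
    by (rule sum.reindex_cong[symmetric, of "\<lambda>i. i - m"])
       (auto simp: inj_on_def intro: assms(2) dest!: assms(2))
  also have "\<dots> \<le> (\<Sum>j. (1/2) ^ j)"
    by (intro sum_le_suminf) (auto simp: assms(1))
  also have "\<dots> = 2" by (simp add: suminf_geometric)
  finally show ?thesis .
qed

text \<open>The properties of \<open>\<phi> powr p\<close> that the estimates rest on. Concavity
  will supply \<open>doubling\<close> with \<open>L = 2 powr p\<close>; the dilation index will
  supply \<open>decay\<close>, with \<open>\<rho>\<close> a power of one contracting dilation. The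
  bound \<open>\<rho> \<le> 1 / 2\<close> lets powers of \<open>\<rho>\<close> be summed like powers
  of one half.\<close>

locale growth =
  fixes g :: "real \<Rightarrow> real" and L \<rho> :: real
  assumes mono: "0 \<le> s \<Longrightarrow> s \<le> t \<Longrightarrow> t \<le> 1 \<Longrightarrow> g s \<le> g t"
    and zero [simp]: "g 0 = 0"
    and pos: "0 < s \<Longrightarrow> s \<le> 1 \<Longrightarrow> 0 < g s"
    and doubling: "0 \<le> s \<Longrightarrow> s \<le> 1 \<Longrightarrow> g s \<le> L * g (s / 2)"
    and \<rho>_pos: "0 < \<rho>" and \<rho>_le: "\<rho> \<le> 1 / 2"
    and decay: "0 \<le> s \<Longrightarrow> s \<le> 1 \<Longrightarrow> g (\<rho> * s) \<le> g s / 2"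
begin

lemma nonneg: "0 \<le> s \<Longrightarrow> s \<le> 1 \<Longrightarrow> 0 \<le> g s"
  using mono[of 0 s] by simp

lemma L_ge_1: "1 \<le> L"
proof -
  have "g (1/2) \<le> g 1" by (rule mono) auto
  also have "g 1 \<le> L * g (1/2)" using doubling[of 1] by simp
  finally show ?thesis using pos[of "1/2"] by simp
qed

lemma le_L_mult:
  assumes "0 \<le> s" "s \<le> 1" "s \<le> 2 * t" "t \<le> 1"
  shows "g s \<le> L * g t"
proof -
  have "g s \<le> L * g (s / 2)" using assms by (intro doubling) auto
  also have "\<dots> \<le> L * g t" using assms L_ge_1 by (intro mult_left_mono mono) auto
  finally show ?thesis .
qed

lemma \<rho>_power: "0 < \<rho> ^ n" "\<rho> ^ n \<le> (1/2) ^ n" "\<rho> ^ n \<le> 1"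
  using \<rho>_pos \<rho>_le by (auto intro: power_mono power_le_one)

lemma decay_power:
  assumes "0 \<le> s" "s \<le> 1"
  shows "g (\<rho> ^ n * s) \<le> g s * (1/2) ^ n"
proof (induction n)
  case (Suc n)
  have "g (\<rho> ^ Suc n * s) \<le> g (\<rho> ^ n * s) / 2"
    using decay[of "\<rho> ^ n * s"] \<rho>_power[of n] assms by (simp add: mult.assoc mult_le_one)
  also have "\<dots> \<le> (g s * (1/2) ^ n) / 2" using Suc by simp
  finally show ?case by simp
qed simp

text \<open>Both sides are comparable to \<open>g\<close> at the largest term, the one with exponent
  \<open>Min I\<close>: the sum of the terms is at most twice that term, and by
  \<open>decay_power\<close> the values of \<open>g\<close> are dominated by a geometric series. The
  index set is arbitrary because it will consist of the coefficients exceeding a given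
  height.\<close>

lemma lacunary:
  fixes I :: "nat set"
  assumes I: "finite I" and e: "0 < e" "e \<le> 1" and le1: "(\<Sum>i\<in>I. \<rho> ^ i * e) \<le> 1"
  shows "g (\<Sum>i\<in>I. \<rho> ^ i * e) \<le> L * (\<Sum>i\<in>I. g (\<rho> ^ i * e))"
    and "(\<Sum>i\<in>I. g (\<rho> ^ i * e)) \<le> 2 * g (\<Sum>i\<in>I. \<rho> ^ i * e)"
proof -
  have "g (\<Sum>i\<in>I. \<rho> ^ i * e) \<le> L * (\<Sum>i\<in>I. g (\<rho> ^ i * e)) \<and>
        (\<Sum>i\<in>I. g (\<rho> ^ i * e)) \<le> 2 * g (\<Sum>i\<in>I. \<rho> ^ i * e)"
  proof (cases "I = {}")
    case False
    define m where "m = Min I"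
    have m: "m \<in> I" "\<And>i. i \<in> I \<Longrightarrow> m \<le> i" using I False by (auto simp: m_def)
    have e01: "0 < \<rho> ^ i * e" "\<rho> ^ i * e \<le> 1" for i
      using \<rho>_power[of i] e by (auto simp: mult_le_one)
    have eq: "\<rho> ^ i * e = \<rho> ^ (i - m) * (\<rho> ^ m * e)" if "i \<in> I" for i
      using m(2)[OF that] by (metis le_add_diff_inverse2 mult.assoc power_add)
    have half: "(\<Sum>i\<in>I. (1/2::real) ^ (i - m)) \<le> 2"
      by (rule sum_half_powers_le) (use I m in auto)
    have "(\<Sum>i\<in>I. \<rho> ^ i * e) \<le> (\<Sum>i\<in>I. (1/2) ^ (i - m) * (\<rho> ^ m * e))"
      using e01[of m] \<rho>_power by (intro sum_mono) (simp only: eq, rule mult_right_mono, auto)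
    also have "\<dots> = (\<Sum>i\<in>I. (1/2) ^ (i - m)) * (\<rho> ^ m * e)" by (simp add: sum_distrib_right)
    also have "\<dots> \<le> 2 * (\<rho> ^ m * e)" using half e01[of m] by (intro mult_right_mono) auto
    finally have "g (\<Sum>i\<in>I. \<rho> ^ i * e) \<le> L * g (\<rho> ^ m * e)"
      using le1 e01 by (intro le_L_mult sum_nonneg) (auto intro: less_imp_le)
    also have "\<dots> \<le> L * (\<Sum>i\<in>I. g (\<rho> ^ i * e))"
      using L_ge_1 I m e01 by (intro mult_left_mono member_le_sum nonneg) (auto intro: less_imp_le)
    finally have 1: "g (\<Sum>i\<in>I. \<rho> ^ i * e) \<le> L * (\<Sum>i\<in>I. g (\<rho> ^ i * e))" .
    have "(\<Sum>i\<in>I. g (\<rho> ^ i * e)) \<le> (\<Sum>i\<in>I. g (\<rho> ^ m * e) * (1/2) ^ (i - m))"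
      using e01[of m] by (intro sum_mono) (simp only: eq, auto intro!: decay_power)
    also have "\<dots> = g (\<rho> ^ m * e) * (\<Sum>i\<in>I. (1/2) ^ (i - m))" by (simp add: sum_distrib_left)
    also have "\<dots> \<le> g (\<rho> ^ m * e) * 2"
      using half e01[of m] by (intro mult_left_mono nonneg) auto
    also have "\<dots> \<le> g (\<Sum>i\<in>I. \<rho> ^ i * e) * 2"
      using le1 I m e01 by (intro mult_right_mono mono member_le_sum) (auto intro: less_imp_le)
    finally show ?thesis using 1 by simp
  qed simp
  then show "g (\<Sum>i\<in>I. \<rho> ^ i * e) \<le> L * (\<Sum>i\<in>I. g (\<rho> ^ i * e))"
    and "(\<Sum>i\<in>I. g (\<rho> ^ i * e)) \<le> 2 * g (\<Sum>i\<in>I. \<rho> ^ i * e)" by auto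
qed

end

section \<open>Distribution functions and the layer-cake formula\<close>

definition distr_fun :: "(real \<Rightarrow> real) \<Rightarrow> real \<Rightarrow> real" where
  "distr_fun x c = measure unit_leb {s \<in> {0..1}. \<bar>x s\<bar> > c}"

interpretation unit_leb: finite_measure unit_leb
  by (rule finite_measure_lebesgue_on) simp

lemma measure_unit_leb_le_1: "measure unit_leb A \<le> 1"
proof -
  have "measure unit_leb A \<le> measure unit_leb (space unit_leb)"
    by (rule unit_leb.bounded_measure)
  then show ?thesis by (simp add: measure_restrict_space)
qed

lemma sum_measure_disjoint_le_1:
  assumes "finite F" "\<And>k. k \<in> F \<Longrightarrow> M k \<in> sets unit_leb" "disjoint_family_on M F"
  shows "(\<Sum>k\<in>F. measure unit_leb (M k)) \<le> 1"
proof -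
  have "measure unit_leb (\<Union>k\<in>F. M k) = (\<Sum>k\<in>F. measure unit_leb (M k))"
    using assms(2) by (intro unit_leb.finite_measure_finite_Union assms(1,3)) blast
  then show ?thesis using measure_unit_leb_le_1[of "\<Union>k\<in>F. M k"] by simp
qed

lemma distr_fun_bounds: "0 \<le> distr_fun x c" "distr_fun x c \<le> 1"
  by (simp_all add: distr_fun_def measure_unit_leb_le_1)

lemma superlevel_sets:
  fixes x :: "real \<Rightarrow> real"
  assumes "x \<in> borel_measurable unit_leb"
  shows "{s \<in> {0..1}. \<bar>x s\<bar> > c} \<in> sets unit_leb"
proof -
  have "{s \<in> space unit_leb. \<bar>x s\<bar> > c} \<in> sets unit_leb"
    by (intro borel_measurable_less borel_measurable_abs borel_measurable_const assms)
  then show ?thesis by simp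
qed

lemma distr_fun_antimono:
  assumes "x \<in> borel_measurable unit_leb" "a \<le> b"
  shows "distr_fun x b \<le> distr_fun x a"
  unfolding distr_fun_def using assms
  by (intro unit_leb.finite_measure_mono superlevel_sets) auto

lemma borel_measurable_distr_fun:
  assumes "x \<in> borel_measurable unit_leb"
  shows "distr_fun x \<in> borel_measurable borel"
proof -
  have "(\<lambda>c. - distr_fun x c) \<in> borel_measurable borel"
    using assms by (intro borel_measurable_mono monoI) (simp add: distr_fun_antimono)
  then show ?thesis by simp
qed

text \<open>The superlevel sets at integer heights decrease to the empty set, since \<open>x\<close>
  is real-valued. This keeps the infimum in \<open>decr_rearr\<close> away from the empty
  set.\<close>

lemma ex_distr_fun_le:
  assumes x: "x \<in> borel_measurable unit_leb" and "0 < t"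
  shows "\<exists>c>0. distr_fun x c \<le> t"
proof -
  define A where "A n = {s \<in> {0..1}. \<bar>x s\<bar> > real (Suc n)}" for n
  have "decseq A" by (auto simp: decseq_def A_def)
  moreover have "range A \<subseteq> sets unit_leb"
    using superlevel_sets[OF x] by (auto simp: A_def)
  ultimately have "(\<lambda>n. measure unit_leb (A n)) \<longlonglongrightarrow> measure unit_leb (\<Inter>n. A n)"
    by (intro unit_leb.finite_Lim_measure_decseq)
  also have "(\<Inter>n. A n) = {}"
  proof -
    have "s \<notin> A (nat \<lceil>\<bar>x s\<bar>\<rceil>)" for s unfolding A_def by (simp; linarith)
    then show ?thesis by blast
  qed
  finally have "eventually (\<lambda>n. measure unit_leb (A n) < t) sequentially"
    using \<open>0 < t\<close> by (intro order_tendstoD) auto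
  then obtain n where "measure unit_leb (A n) < t" by (auto dest: eventually_happens)
  then show ?thesis by (intro exI[of _ "real (Suc n)"]) (auto simp: A_def distr_fun_def)
qed

text \<open>For fixed \<open>t\<close> these facts identify the heights \<open>c > 0\<close> with
  \<open>t < distr_fun x c\<close> as an interval from 0 to \<open>decr_rearr x t\<close>, up to its
  right end point.\<close>

lemma
  assumes x: "x \<in> borel_measurable unit_leb" and t: "0 < t"
  shows decr_rearr_nonneg: "0 \<le> decr_rearr x t"
    and less_distr_fun: "0 < c \<Longrightarrow> c < decr_rearr x t \<Longrightarrow> t < distr_fun x c"
    and le_decr_rearr: "0 < c \<Longrightarrow> t < distr_fun x c \<Longrightarrow> c \<le> decr_rearr x t"
proof -
  define S where "S = {c. c > 0 \<and> distr_fun x c \<le> t}"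
  have S: "decr_rearr x t = Inf S" by (simp add: decr_rearr_def S_def distr_fun_def)
  have ne: "S \<noteq> {}" using ex_distr_fun_le[OF x t] by (auto simp: S_def)
  have bdd: "bdd_below S" by (rule bdd_belowI[of _ 0]) (auto simp: S_def)
  show "0 \<le> decr_rearr x t" unfolding S by (rule cInf_greatest[OF ne]) (auto simp: S_def)
  show "t < distr_fun x c" if "0 < c" "c < decr_rearr x t"
  proof (rule ccontr)
    assume "\<not> t < distr_fun x c"
    then have "c \<in> S" using that by (auto simp: S_def)
    then show False using cInf_lower[OF _ bdd] that S by fastforce
  qed
  show "c \<le> decr_rearr x t" if "0 < c" "t < distr_fun x c"
    unfolding S
  proof (rule cInf_greatest[OF ne])
    fix b assume "b \<in> S"
    then have "distr_fun x b < distr_fun x c" using that by (auto simp: S_def)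
    then show "c \<le> b" using distr_fun_antimono[OF x, of b c] by linarith
  qed
qed

text \<open>The density of d(c powr p) on the positive half-line, so that its mass on the heights
  below \<open>R\<close> is \<open>R powr p\<close>.\<close>

definition layer_density :: "real \<Rightarrow> real \<Rightarrow> ennreal" where
  "layer_density p c = ennreal (p * c powr (p - 1)) * indicator {0<..} c"

lemma layer_density_measurable [measurable]: "layer_density p \<in> borel_measurable borel"
  unfolding layer_density_def by measurable

text \<open>\<open>P\<close> is left open at \<open>R\<close> itself, which matches what is known
  about the relation between rearrangement and distribution function; the single points 0 and
  \<open>R\<close> carry no mass.\<close>

lemma nn_integral_layer_density:
  assumes p: "1 \<le> p" and R: "0 \<le> R"
    and P: "\<And>c. 0 < c \<Longrightarrow> c < R \<Longrightarrow> P c" "\<And>c. 0 < c \<Longrightarrow> P c \<Longrightarrow> c \<le> R"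
  shows "(\<integral>\<^sup>+c. layer_density p c * indicator {c. P c} c \<partial>lborel) = ennreal (R powr p)"
proof -
  have "((\<lambda>c. p * c powr (p - 1)) has_integral p * (R powr (p - 1 + 1) / (p - 1 + 1))) {0..R}"
    using p R by (intro has_integral_mult_right has_integral_powr_from_0) auto
  then have "((\<lambda>c. p * c powr (p - 1)) has_integral R powr p) {0..R}"
    using p by simp
  then have "(\<integral>\<^sup>+c. ennreal (p * c powr (p - 1)) * indicator {0..R} c \<partial>lborel) = ennreal (R powr p)"
    using p by (intro nn_integral_has_integral_lebesgue') auto
  moreover have "(\<integral>\<^sup>+c. layer_density p c * indicator {c. P c} c \<partial>lborel) =
      (\<integral>\<^sup>+c. ennreal (p * c powr (p - 1)) * indicator {0..R} c \<partial>lborel)"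
  proof (rule nn_integral_cong_AE)
    show "AE c in lborel. layer_density p c * indicator {c. P c} c =
        ennreal (p * c powr (p - 1)) * indicator {0..R} c"
      using AE_lborel_singleton[of R] AE_lborel_singleton[of 0]
    proof eventually_elim
      case (elim c)
      show ?case
      proof (cases "0 < c")
        case True
        with elim P[of c] have "P c \<longleftrightarrow> c \<in> {0..R}" by force
        with True show ?thesis by (simp add: layer_density_def indicator_def)
      qed (use elim in \<open>auto simp: layer_density_def\<close>)
    qed
  qed
  ultimately show ?thesis by simp
qed

section \<open>The integral of g(t)/t and its comparison with g\<close>

context growth
begin

text \<open>Values in \<open>ennreal\<close> allow Tonelli before integrability is known. The
  interval is open at \<open>s\<close> to match the strict inequality
  \<open>t < distr_fun x c\<close>.\<close>

definition primitive :: "real \<Rightarrow> ennreal" where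
  "primitive s = (\<integral>\<^sup>+t. ennreal (g t / t) * indicator {0<..<s} t \<partial>lborel)"

text \<open>\<open>g\<close> is monotone on the unit interval only; clamping the argument makes it
  monotone, hence Borel, on the whole line.\<close>

lemma g_measurable: "(\<lambda>t. g (max 0 (min 1 t))) \<in> borel_measurable borel"
  by (intro borel_measurable_mono monoI mono) auto

lemma primitive_0 [simp]: "primitive 0 = 0"
  by (simp add: primitive_def)

text \<open>The upper half of the interval suffices: there the integrand is at least
  \<open>g (s / 2) / s\<close>, which contributes \<open>g (s / 2) / 2\<close>, and
  \<open>doubling\<close> returns to \<open>g s\<close>.\<close>

lemma primitive_ge:
  assumes "0 \<le> s" "s \<le> 1"
  shows "ennreal (g s) \<le> ennreal (2 * L) * primitive s"
proof (cases "s = 0")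
  case False
  then have s: "0 < s" using assms by simp
  have "ennreal (g s) \<le> ennreal (L * g (s / 2))" using doubling assms by (intro ennreal_leI) auto
  also have "\<dots> = ennreal (2 * L * (g (s / 2) / s * (s / 2)))" using s by simp
  also have "\<dots> = ennreal (2 * L) * (\<integral>\<^sup>+t. ennreal (g (s / 2) / s) * indicator {s/2<..<s} t \<partial>lborel)"
    using s assms L_ge_1 nonneg[of "s/2"]
    by (simp add: nn_integral_cmult_indicator ennreal_mult[symmetric])
  also have "\<dots> \<le> ennreal (2 * L) * primitive s"
    unfolding primitive_def
  proof (intro mult_left_mono nn_integral_mono)
    fix t
    have "g (s / 2) / s \<le> g t / t" if "t \<in> {s/2<..<s}"
      using that s assms nonneg[of "s/2"] by (intro frac_le mono nonneg) auto
    then show "ennreal (g (s / 2) / s) * indicator {s/2<..<s} t \<le> ennreal (g t / t) * indicator {0<..<s} t"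
      using s by (auto simp: indicator_def intro!: ennreal_leI)
  qed auto
  finally show ?thesis .
qed simp

text \<open>On the piece \<open>J n\<close> of a geometric partition with ratio
  \<open>\<rho>\<close>, decay bounds \<open>g\<close> by \<open>g s * (1/2) ^ n\<close>, while 1/t
  is at most \<open>1 / (\<rho> ^ Suc n * s)\<close>. The piece is shorter than
  \<open>\<rho> ^ n * s\<close>, so it contributes at most
  \<open>g s / \<rho> * (1/2) ^ n\<close>.\<close>

lemma primitive_le:
  assumes "0 \<le> s" "s \<le> 1"
  shows "primitive s \<le> ennreal (2 / \<rho>) * ennreal (g s)"
proof (cases "s = 0")
  case False
  then have s: "0 < s" using assms by simp
  define J where "J n = {\<rho> ^ Suc n * s..<\<rho> ^ n * s}" for n
  define h where "h n = g s * (1/2) ^ n / (\<rho> ^ Suc n * s)" for n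
  have h: "0 \<le> h n" for n using assms nonneg[of s] \<rho>_pos by (simp add: h_def)
  have single: "f n \<le> suminf f" for f :: "nat \<Rightarrow> ennreal" and n
    using sum_le_suminf[of f "{n}"] by simp
  have "primitive s \<le> (\<integral>\<^sup>+t. (\<Sum>n. ennreal (h n) * indicator (J n) t) \<partial>lborel)"
    unfolding primitive_def
  proof (intro nn_integral_mono)
    fix t
    show "ennreal (g t / t) * indicator {0<..<s} t \<le> (\<Sum>n. ennreal (h n) * indicator (J n) t)"
    proof (cases "t \<in> {0<..<s}")
      case True
      have "(\<lambda>n. \<rho> ^ n * s) \<longlonglongrightarrow> 0 * s"
        using \<rho>_pos \<rho>_le by (intro tendsto_mult LIMSEQ_realpow_zero) auto
      then have "eventually (\<lambda>n. \<rho> ^ n * s < t) sequentially"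
        using True by (intro order_tendstoD) auto
      then obtain N where N: "\<rho> ^ N * s < t" by (auto dest: eventually_happens)
      \<comment> \<open>The piece containing \<open>t\<close>: minimality gives its upper end, and
        for \<open>n = 0\<close> that end is \<open>s\<close> itself.\<close>
      define n where "n = (LEAST n. \<rho> ^ Suc n * s \<le> t)"
      have "\<rho> ^ Suc N * s \<le> \<rho> ^ N * s" using s \<rho>_pos \<rho>_le by (auto intro!: mult_left_le_one_le)
      with N have exN: "\<rho> ^ Suc N * s \<le> t" by linarith
      have n1: "\<rho> ^ Suc n * s \<le> t" unfolding n_def by (rule LeastI, rule exN)
      have n2: "t < \<rho> ^ n * s"
      proof (cases n)
        case (Suc m)
        then have "\<not> \<rho> ^ Suc m * s \<le> t" unfolding n_def by (intro not_less_Least) auto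
        then show ?thesis using Suc by simp
      qed (use True in auto)
      have "g t \<le> g (\<rho> ^ n * s)"
        using True n2 \<rho>_power[of n] assms by (intro mono) (auto simp: mult_le_one)
      also have "\<dots> \<le> g s * (1/2) ^ n" using assms by (intro decay_power)
      finally have "g t / t \<le> h n" unfolding h_def
        using n1 True s assms \<rho>_pos nonneg[of s] by (intro frac_le) auto
      then have "ennreal (g t / t) * indicator {0<..<s} t \<le> ennreal (h n) * indicator (J n) t"
        using True n1 n2 by (simp add: J_def ennreal_leI)
      also have "\<dots> \<le> (\<Sum>n. ennreal (h n) * indicator (J n) t)"
        by (rule single)
      finally show ?thesis .
    qed simp
  qed
  also have "\<dots> = (\<Sum>n. (\<integral>\<^sup>+t. ennreal (h n) * indicator (J n) t \<partial>lborel))"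
    by (rule nn_integral_suminf) (simp add: J_def)
  also have "\<dots> = (\<Sum>n. ennreal (h n * (\<rho> ^ n * s - \<rho> ^ Suc n * s)))"
  proof (rule suminf_cong)
    fix n
    have "\<rho> ^ Suc n * s \<le> \<rho> ^ n * s" using s \<rho>_pos \<rho>_le by (auto intro!: mult_left_le_one_le)
    then show "(\<integral>\<^sup>+t. ennreal (h n) * indicator (J n) t \<partial>lborel) = ennreal (h n * (\<rho> ^ n * s - \<rho> ^ Suc n * s))"
      using h[of n] by (simp add: nn_integral_cmult_indicator J_def ennreal_mult)
  qed
  also have "\<dots> \<le> (\<Sum>n. ennreal (g s / \<rho> * (1/2) ^ n))"
  proof (intro suminf_le ennreal_leI)
    fix n
    have "h n * (\<rho> ^ n * s - \<rho> ^ Suc n * s) \<le> h n * (\<rho> ^ n * s)"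
      using h[of n] s \<rho>_pos by (intro mult_left_mono) auto
    also have "\<dots> = g s / \<rho> * (1/2) ^ n" using s \<rho>_pos by (simp add: h_def field_simps)
    finally show "h n * (\<rho> ^ n * s - \<rho> ^ Suc n * s) \<le> g s / \<rho> * (1/2) ^ n" .
  qed auto
  also have "\<dots> = ennreal (\<Sum>n. g s / \<rho> * (1/2) ^ n)"
    using nonneg[OF assms] \<rho>_pos by (intro suminf_ennreal2 summable_mult summable_geometric) auto
  also have "(\<Sum>n. g s / \<rho> * (1/2) ^ n) = 2 / \<rho> * g s"
    by (subst suminf_mult) (simp_all add: suminf_geometric)
  also have "ennreal (2 / \<rho> * g s) = ennreal (2 / \<rho>) * ennreal (g s)"
    using nonneg[OF assms] \<rho>_pos by (intro ennreal_mult) auto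
  finally show ?thesis .
qed simp

lemma primitive_finite: "0 \<le> s \<Longrightarrow> s \<le> 1 \<Longrightarrow> primitive s < \<infinity>"
  by (rule le_less_trans[OF primitive_le]) (auto simp: ennreal_mult_less_top)

end

lemma distr_fun_indicator:
  assumes "E \<in> sets unit_leb" "0 < b" "0 < c"
  shows "distr_fun (\<lambda>t. b * indicator E t) c = (if c < b then measure unit_leb E else 0)"
proof -
  have "E \<subseteq> {0..1}" using sets.sets_into_space[OF assms(1)] by simp
  then have "{s \<in> {0..1}. \<bar>b * indicator E s\<bar> > c} = (if c < b then E else {})"
    using assms by (auto simp: indicator_def abs_mult split: if_splits)
  then show ?thesis by (simp add: distr_fun_def)
qed

text \<open>\<open>\<phi>\<close> enters only through the definition of the modular; all estimates
  are stated in terms of \<open>g\<close>. The two are tied together on the unit interval, where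
  distribution functions take their values.\<close>

locale lorentz_growth = growth +
  fixes \<phi> :: "real \<Rightarrow> real" and p :: real
  assumes p: "1 \<le> p"
    and \<phi>_nonneg: "0 \<le> t \<Longrightarrow> t \<le> 1 \<Longrightarrow> 0 \<le> \<phi> t"
    and g_eq: "0 \<le> t \<Longrightarrow> t \<le> 1 \<Longrightarrow> g t = \<phi> t powr p"
begin

text \<open>The clamped form has an integrand that is jointly measurable in \<open>t\<close> and
  \<open>c\<close>, as Tonelli requires.\<close>

lemma primitive_distr_fun:
  "primitive (distr_fun x c) =
    (\<integral>\<^sup>+t. ennreal (g (max 0 (min 1 t)) / t) * indicator {t. 0 < t \<and> t < distr_fun x c} t \<partial>lborel)"
  unfolding primitive_def using distr_fun_bounds[of x c]
  by (intro nn_integral_cong) (auto simp: indicator_def)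

lemma primitive_distr_fun_measurable:
  assumes "x \<in> borel_measurable unit_leb"
  shows "(\<lambda>c. primitive (distr_fun x c)) \<in> borel_measurable borel"
proof -
  note [measurable] = borel_measurable_distr_fun[OF assms] g_measurable
  show ?thesis unfolding primitive_distr_fun by measurable
qed

text \<open>The power \<open>decr_rearr x t powr p\<close> is the \<open>layer_density\<close> mass
  of the heights with \<open>t < distr_fun x c\<close>; exchanging the integrals leaves, at each
  height, the integral of g(t)/t up to \<open>distr_fun x c\<close>.\<close>

lemma lorentz_modular_layer_cake:
  assumes x: "x \<in> borel_measurable unit_leb"
  shows "lorentz_modular p \<phi> x =
    (\<integral>\<^sup>+c. layer_density p c * primitive (distr_fun x c) \<partial>lborel)"
proof -
  note [measurable] = borel_measurable_distr_fun[OF x] g_measurable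
  define G where "G t = ennreal (g (max 0 (min 1 t)) / t)" for t
  have [measurable]: "G \<in> borel_measurable borel" unfolding G_def by measurable
  define T where "T = (\<lambda>t c. indicator {t. 0 < t \<and> t < distr_fun x c} t :: ennreal)"
  have [measurable]: "case_prod T \<in> borel_measurable (lborel \<Otimes>\<^sub>M lborel)"
    unfolding T_def by measurable
  have T1: "(\<lambda>t. T t c) \<in> borel_measurable borel" for c unfolding T_def by measurable
  have T2: "(\<lambda>c. T t c) \<in> borel_measurable borel" for t unfolding T_def by measurable
  have "lorentz_modular p \<phi> x =
      (\<integral>\<^sup>+t. ennreal ((decr_rearr x t * \<phi> t) powr p / t) * indicator {0..1} t \<partial>lborel)"
    unfolding lorentz_modular_def by (simp add: nn_integral_restrict_space nn_integral_completion)
  also have "\<dots> = (\<integral>\<^sup>+t. (\<integral>\<^sup>+c. G t * (layer_density p c * T t c) \<partial>lborel) \<partial>lborel)"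
  proof (rule nn_integral_cong)
    fix t
    have eq: "(\<integral>\<^sup>+c. G t * (layer_density p c * T t c) \<partial>lborel) =
        G t * (\<integral>\<^sup>+c. layer_density p c * T t c \<partial>lborel)"
      using T2 by (intro nn_integral_cmult) simp
    show "ennreal ((decr_rearr x t * \<phi> t) powr p / t) * indicator {0..1} t =
        (\<integral>\<^sup>+c. G t * (layer_density p c * T t c) \<partial>lborel)"
    proof (cases "0 < t \<and> t \<le> 1")
      case True
      have "(\<integral>\<^sup>+c. layer_density p c * T t c \<partial>lborel) =
          (\<integral>\<^sup>+c. layer_density p c * indicator {c. t < distr_fun x c} c \<partial>lborel)"
        using True by (intro nn_integral_cong) (simp add: T_def indicator_def)
      also have "\<dots> = ennreal (decr_rearr x t powr p)"
        using True decr_rearr_nonneg[OF x, of t] less_distr_fun[OF x, of t] le_decr_rearr[OF x, of t]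
        by (intro nn_integral_layer_density p) auto
      finally show ?thesis
        using True decr_rearr_nonneg[OF x, of t] \<phi>_nonneg[of t] nonneg[of t]
        unfolding eq unfolding G_def by (simp add: powr_mult g_eq ennreal_mult[symmetric] mult.commute)
    next
      case False
      have "T t c = 0" for c
        using False distr_fun_bounds(2)[of x c] by (auto simp: T_def indicator_def)
      \<comment> \<open>At \<open>t = 0\<close> the left integrand is 0 as well, because division by
        0 yields 0.\<close>
      then show ?thesis using False by (cases "t = 0") (auto simp: indicator_def)
    qed
  qed
  also have "\<dots> = (\<integral>\<^sup>+c. (\<integral>\<^sup>+t. G t * (layer_density p c * T t c) \<partial>lborel) \<partial>lborel)"
    by (rule lborel_pair.Fubini'[symmetric]) measurable
  also have "\<dots> = (\<integral>\<^sup>+c. layer_density p c * primitive (distr_fun x c) \<partial>lborel)"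
  proof (rule nn_integral_cong)
    fix c
    have "(\<integral>\<^sup>+t. G t * (layer_density p c * T t c) \<partial>lborel) =
        (\<integral>\<^sup>+t. layer_density p c * (G t * T t c) \<partial>lborel)"
      by (simp add: mult.left_commute)
    also have "\<dots> = layer_density p c * (\<integral>\<^sup>+t. G t * T t c \<partial>lborel)"
      using T1 by (intro nn_integral_cmult) simp
    finally show "(\<integral>\<^sup>+t. G t * (layer_density p c * T t c) \<partial>lborel) =
        layer_density p c * primitive (distr_fun x c)"
      by (simp add: primitive_distr_fun G_def T_def)
  qed
  finally show ?thesis .
qed

text \<open>The product of the constants \<open>2 * L\<close> and \<open>2 / \<rho>\<close>, the
  price of passing from \<open>primitive\<close> to \<open>g\<close> and back.\<close>

definition modular_const :: real where "modular_const = 4 * L / \<rho>"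

lemma modular_const_pos: "0 < modular_const"
  using L_ge_1 \<rho>_pos by (simp add: modular_const_def)

text \<open>The transfer principle behind all norm comparisons. Finite families stand on both sides
  so that one statement covers a sum of modulars against the modular of a sum; the latter is the
  family over \<open>{()}\<close>.\<close>

lemma sum_lorentz_modular_le:
  assumes K: "0 \<le> K" and fin: "finite I" "finite J"
    and x: "\<And>i. i \<in> I \<Longrightarrow> x i \<in> borel_measurable unit_leb"
    and y: "\<And>j. j \<in> J \<Longrightarrow> y j \<in> borel_measurable unit_leb"
    and le: "\<And>c. 0 < c \<Longrightarrow> (\<Sum>i\<in>I. g (distr_fun (x i) c)) \<le> K * (\<Sum>j\<in>J. g (distr_fun (y j) c))"
  shows "(\<Sum>i\<in>I. lorentz_modular p \<phi> (x i)) \<le> ennreal (K * modular_const) * (\<Sum>j\<in>J. lorentz_modular p \<phi> (y j))"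
proof -
  have meas: "(\<lambda>c. layer_density p c * primitive (distr_fun z c)) \<in> borel_measurable borel"
    if "z \<in> borel_measurable unit_leb" for z
    using primitive_distr_fun_measurable[OF that] by simp
  have g0: "0 \<le> g (distr_fun z c)" for z c by (intro nonneg distr_fun_bounds)
  have "(\<Sum>i\<in>I. lorentz_modular p \<phi> (x i)) =
      (\<integral>\<^sup>+c. (\<Sum>i\<in>I. layer_density p c * primitive (distr_fun (x i) c)) \<partial>lborel)"
    using x by (subst nn_integral_sum) (auto simp: lorentz_modular_layer_cake meas)
  also have "\<dots> \<le> (\<integral>\<^sup>+c. ennreal (K * modular_const) *
      (\<Sum>j\<in>J. layer_density p c * primitive (distr_fun (y j) c)) \<partial>lborel)"
  proof (rule nn_integral_mono)
    fix c
    show "(\<Sum>i\<in>I. layer_density p c * primitive (distr_fun (x i) c)) \<le>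
        ennreal (K * modular_const) * (\<Sum>j\<in>J. layer_density p c * primitive (distr_fun (y j) c))"
    proof (cases "0 < c")
      case True
      have "(\<Sum>i\<in>I. primitive (distr_fun (x i) c)) \<le> (\<Sum>i\<in>I. ennreal (2 / \<rho>) * ennreal (g (distr_fun (x i) c)))"
        by (intro sum_mono primitive_le distr_fun_bounds)
      also have "\<dots> = ennreal (2 / \<rho>) * ennreal (\<Sum>i\<in>I. g (distr_fun (x i) c))"
        using g0 by (simp add: sum_distrib_left[symmetric] sum_ennreal)
      also have "\<dots> \<le> ennreal (2 / \<rho>) * ennreal (K * (\<Sum>j\<in>J. g (distr_fun (y j) c)))"
        using le[OF True] by (intro mult_left_mono ennreal_leI) auto
      also have "\<dots> = ennreal (2 / \<rho>) * ennreal K * (\<Sum>j\<in>J. ennreal (g (distr_fun (y j) c)))"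
        using g0 K by (simp add: ennreal_mult sum_nonneg sum_ennreal mult.assoc)
      also have "\<dots> \<le> ennreal (2 / \<rho>) * ennreal K * (\<Sum>j\<in>J. ennreal (2 * L) * primitive (distr_fun (y j) c))"
        by (intro mult_left_mono sum_mono primitive_ge distr_fun_bounds) auto
      also have "\<dots> = ennreal (2 / \<rho>) * ennreal K * ennreal (2 * L) * (\<Sum>j\<in>J. primitive (distr_fun (y j) c))"
        by (simp add: sum_distrib_left mult.assoc)
      also have "ennreal (2 / \<rho>) * ennreal K * ennreal (2 * L) = ennreal (K * modular_const)"
        using \<rho>_pos K L_ge_1 by (simp add: ennreal_mult[symmetric] modular_const_def mult.commute)
      finally have "layer_density p c * (\<Sum>i\<in>I. primitive (distr_fun (x i) c)) \<le>
          layer_density p c * (ennreal (K * modular_const) * (\<Sum>j\<in>J. primitive (distr_fun (y j) c)))"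
        by (rule mult_left_mono) simp
      then show ?thesis by (simp add: sum_distrib_left mult.left_commute)
    qed (simp add: layer_density_def)
  qed
  also have "\<dots> = ennreal (K * modular_const) *
      (\<integral>\<^sup>+c. (\<Sum>j\<in>J. layer_density p c * primitive (distr_fun (y j) c)) \<partial>lborel)"
    using y by (intro nn_integral_cmult) (auto intro!: borel_measurable_sum meas)
  also have "(\<integral>\<^sup>+c. (\<Sum>j\<in>J. layer_density p c * primitive (distr_fun (y j) c)) \<partial>lborel) =
      (\<Sum>j\<in>J. lorentz_modular p \<phi> (y j))"
    using y by (subst nn_integral_sum) (auto simp: lorentz_modular_layer_cake meas)
  finally show ?thesis .
qed

text \<open>An identity without constants, which makes it possible to prescribe the norm of a
  multiple of an indicator exactly.\<close>

lemma lorentz_modular_indicator: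
  assumes E: "E \<in> sets unit_leb" and b: "0 < b"
  shows "lorentz_modular p \<phi> (\<lambda>t. b * indicator E t) = ennreal (b powr p) * primitive (measure unit_leb E)"
proof -
  have [measurable]: "(\<lambda>t. b * indicator E t) \<in> borel_measurable unit_leb"
    using E by (intro borel_measurable_times borel_measurable_indicator) auto
  have "lorentz_modular p \<phi> (\<lambda>t. b * indicator E t) =
      (\<integral>\<^sup>+c. layer_density p c * indicator {c. c < b} c * primitive (measure unit_leb E) \<partial>lborel)"
    unfolding lorentz_modular_layer_cake[OF \<open>(\<lambda>t. b * indicator E t) \<in> borel_measurable unit_leb\<close>]
  proof (rule nn_integral_cong)
    fix c
    show "layer_density p c * primitive (distr_fun (\<lambda>t. b * indicator E t) c) =
        layer_density p c * indicator {c. c < b} c * primitive (measure unit_leb E)"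
      using distr_fun_indicator[OF E b] by (cases "0 < c") (auto simp: layer_density_def indicator_def)
  qed
  also have "\<dots> = (\<integral>\<^sup>+c. layer_density p c * indicator {c. c < b} c \<partial>lborel) * primitive (measure unit_leb E)"
    by (intro nn_integral_multc) measurable
  also have "(\<integral>\<^sup>+c. layer_density p c * indicator {c. c < b} c \<partial>lborel) = ennreal (b powr p)"
    using b by (intro nn_integral_layer_density p) auto
  finally show ?thesis .
qed

end

section \<open>Rearranged families\<close>

text \<open>A value \<open>c < m\<close> has all of \<open>A\<close>, hence more than
  \<open>r\<close> indices, above it. The bound by 1 makes 1 an admissible value, so the infimum is
  not taken over the empty set.\<close>

lemma le_family_rearr:
  fixes a :: "'i \<Rightarrow> real"
  assumes bdd: "\<And>k. a k \<le> 1" and A: "finite A" "r < card A" "\<And>k. k \<in> A \<Longrightarrow> m \<le> a k"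
  shows "m \<le> family_rearr a r"
  unfolding family_rearr_def
proof (rule cInf_greatest)
  have "{k. a k > 1} = {}" using bdd by (auto simp: not_less)
  then have "1 \<in> {c. c \<ge> 0 \<and> finite {k. a k > c} \<and> card {k. a k > c} \<le> r}"
    unfolding mem_Collect_eq by simp
  then show "{c. c \<ge> 0 \<and> finite {k. a k > c} \<and> card {k. a k > c} \<le> r} \<noteq> {}" by blast
next
  fix c assume c: "c \<in> {c. c \<ge> 0 \<and> finite {k. a k > c} \<and> card {k. a k > c} \<le> r}"
  show "m \<le> c"
  proof (rule ccontr)
    assume "\<not> m \<le> c"
    then have "A \<subseteq> {k. a k > c}" using A(3) by force
    then have "card A \<le> card {k. a k > c}" using c by (intro card_mono) auto
    then show False using c A(2) by auto
  qed
qed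

text \<open>Enumerate \<open>F\<close> by decreasing \<open>a\<close>: the first
  \<open>j + 1\<close> indices all have values at least \<open>a (e j)\<close>, so
  \<open>le_family_rearr\<close> applies.\<close>

lemma ex_enumeration_le_family_rearr:
  fixes a :: "'i \<Rightarrow> real"
  assumes bdd: "\<And>k. a k \<le> 1" and F: "finite F"
  shows "\<exists>e. bij_betw e {..<card F} F \<and> (\<forall>j<card F. a (e j) \<le> family_rearr a j)"
proof -
  obtain ys where ys: "set ys = F" "distinct ys" using finite_distinct_list[OF F] by blast
  define xs where "xs = sort_key (\<lambda>k. - a k) ys"
  have xs: "set xs = F" "distinct xs" "sorted (map (\<lambda>k. - a k) xs)"
    using ys by (simp_all add: xs_def)
  have len: "length xs = card F" using xs distinct_card by metis
  have bij: "bij_betw ((!) xs) {..<card F} F"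
    using xs by (intro bij_betw_nth) (auto simp: len)
  have "a (xs ! j) \<le> family_rearr a j" if j: "j < card F" for j
  proof (rule le_family_rearr[OF bdd, of "(!) xs ` {..j}"])
    have "inj_on ((!) xs) {..j}"
      using bij j by (auto simp: bij_betw_def intro: inj_on_subset)
    then show "j < card ((!) xs ` {..j})" by (simp add: card_image)
    fix k assume "k \<in> (!) xs ` {..j}"
    then obtain i where i: "i \<le> j" "k = xs ! i" by auto
    then show "a (xs ! j) \<le> a k"
      using sorted_nth_mono[OF xs(3), of i j] j by (simp add: len)
  qed simp
  then show ?thesis using bij by blast
qed

text \<open>Greedy choice: strictness means that more than \<open>N\<close> indices lie above
  \<open>c N\<close>, so one of them has not been used by the first \<open>N\<close>
  choices.\<close>

lemma ex_inj_less_of_less_family_rearr: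
  fixes a :: "'i \<Rightarrow> real" and c :: "nat \<Rightarrow> real"
  assumes "\<And>j. j < N \<Longrightarrow> 0 \<le> c j" "\<And>j. j < N \<Longrightarrow> c j < family_rearr a j"
  shows "\<exists>k. inj_on k {..<N} \<and> (\<forall>j<N. c j < a (k j))"
  using assms
proof (induction N)
  case (Suc N)
  then obtain k where k: "inj_on k {..<N}" "\<forall>j<N. c j < a (k j)" by force
  define S where "S = {k. a k > c N}"
  have "infinite S \<or> N < card S"
  proof (rule ccontr)
    assume "\<not> ?thesis"
    then have "family_rearr a N \<le> c N"
      unfolding family_rearr_def using Suc.prems(1)[of N]
      by (intro cInf_lower bdd_belowI[of _ 0]) (auto simp: S_def)
    then show False using Suc.prems(2)[of N] by simp
  qed
  moreover have "card (k ` {..<N}) \<le> N" using card_image_le[of "{..<N}" k] by simp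
  ultimately have "\<not> S \<subseteq> k ` {..<N}"
    by (metis card_mono finite_imageI finite_lessThan finite_subset leD order.strict_trans2)
  then obtain q where q: "c N < a q" "q \<notin> k ` {..<N}" by (auto simp: S_def)
  have "inj_on (k(N := q)) {..<Suc N}"
    using k(1) q(2) by (auto simp: inj_on_def less_Suc_eq)
  moreover have "\<forall>j<Suc N. c j < a ((k(N := q)) j)" using k(2) q(1) by (auto simp: less_Suc_eq)
  ultimately show ?case by blast
qed simp

lemma family_rearr_pos:
  fixes a :: "'i \<Rightarrow> real"
  assumes bdd: "\<And>k. a k \<le> 1" and inf: "infinite {k. 0 < a k}"
  shows "0 < family_rearr a r"
proof -
  obtain A where A: "A \<subseteq> {k. 0 < a k}" "finite A" "card A = Suc r"
    using infinite_arbitrarily_large[OF inf] by blast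
  then have "A \<noteq> {}" by auto
  then have "0 < Min (a ` A)" using A by auto
  also have "\<dots> \<le> family_rearr a r" using A by (intro le_family_rearr[OF bdd, of A]) auto
  finally show ?thesis .
qed

lemma
  fixes a :: "'i \<Rightarrow> real"
  assumes sum: "\<And>F. finite F \<Longrightarrow> (\<Sum>k\<in>F. a k) \<le> 1"
    and \<tau>: "\<And>r. 0 < \<tau> r" "\<And>r. \<tau> r \<le> family_rearr a r"
  shows summable_le_family_rearr: "summable \<tau>"
    and suminf_le_family_rearr: "suminf \<tau> \<le> 1"
proof -
  have le: "(\<Sum>j<N. \<tau> j) \<le> 1" for N
  \<comment> \<open>The terms \<open>\<tau> j\<close> may equal the rearrangement; the factor
    \<open>z < 1\<close> creates the strict inequality that the choice of distinct indices
    requires.\<close>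
  proof (rule field_le_mult_one_interval)
    fix z :: real assume z: "0 < z" "z < 1"
    have "z * \<tau> j < family_rearr a j" for j
    proof -
      have "z * \<tau> j < 1 * \<tau> j" by (rule mult_strict_right_mono) (use z \<tau> in auto)
      then show ?thesis using \<tau>(2)[of j] by simp
    qed
    moreover have "0 \<le> z * \<tau> j" for j using z \<tau>(1)[of j] by simp
    ultimately obtain k where k: "inj_on k {..<N}" "\<forall>j<N. z * \<tau> j < a (k j)"
      using ex_inj_less_of_less_family_rearr[of N "\<lambda>j. z * \<tau> j" a] by auto
    have "z * (\<Sum>j<N. \<tau> j) \<le> (\<Sum>j<N. a (k j))"
      unfolding sum_distrib_left using k(2) by (intro sum_mono) (auto intro: less_imp_le)
    also have "\<dots> = (\<Sum>q\<in>k ` {..<N}. a q)" by (simp add: sum.reindex[OF k(1)])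
    also have "\<dots> \<le> 1" by (rule sum) simp
    finally show "z * (\<Sum>j<N. \<tau> j) \<le> 1" .
  qed
  show "summable \<tau>"
    using le \<tau>(1) by (intro summableI_nonneg_bounded[of _ 1]) (auto intro: less_imp_le)
  then show "suminf \<tau> \<le> 1" using le by (intro suminf_le_const) auto
qed

section \<open>The sequence condition and its form for finite families\<close>

context growth
begin

text \<open>The condition of the theorem raised to the power \<open>p\<close>, with \<open>K\<close>
  in the role of \<open>C powr p\<close>. Summability is stated separately because
  \<open>suminf\<close> of a divergent series carries no information.\<close>

definition seq_decomposable :: "('i \<Rightarrow> real) \<Rightarrow> real \<Rightarrow> bool" where
  "seq_decomposable a K \<longleftrightarrow> (\<forall>\<tau>. (\<forall>r. 0 < \<tau> r \<and> \<tau> r \<le> family_rearr a r) \<longrightarrow>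
     summable (\<lambda>r. g (\<tau> r)) \<and> g (suminf \<tau>) \<le> K * (\<Sum>r. g (\<tau> r)) \<and> (\<Sum>r. g (\<tau> r)) \<le> K * g (suminf \<tau>))"

text \<open>The positive members of the family, enumerated by decreasing \<open>a\<close>, form the
  start of an admissible sequence. A geometric tail completes it and at most doubles both the sum
  and the sum of the values of \<open>g\<close>.\<close>

lemma seq_decomposable_finite:
  fixes a :: "'i \<Rightarrow> real"
  assumes K: "0 < K" "seq_decomposable a K"
    and inf: "infinite {k. 0 < a k}"
    and sum_a: "\<And>F. finite F \<Longrightarrow> (\<Sum>k\<in>F. a k) \<le> 1"
    and F: "finite F" and b: "\<And>k. k \<in> F \<Longrightarrow> 0 \<le> b k" "\<And>k. k \<in> F \<Longrightarrow> b k \<le> a k"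
  shows "g (\<Sum>k\<in>F. b k) \<le> 2 * K * L * (\<Sum>k\<in>F. g (b k))"
    and "(\<Sum>k\<in>F. g (b k)) \<le> 2 * K * L * g (\<Sum>k\<in>F. b k)"
proof -
  have a1: "a k \<le> 1" for k using sum_a[of "{k}"] by simp
  define F' where "F' = {k \<in> F. 0 < b k}"
  have F': "finite F'" using F by (simp add: F'_def)
  have bz: "b k = 0" "g (b k) = 0" if "k \<in> F" "\<not> 0 < b k" for k
    using that b(1)[of k] by (auto dest: antisym)
  have sF: "(\<Sum>k\<in>F. b k) = (\<Sum>k\<in>F'. b k)" "(\<Sum>k\<in>F. g (b k)) = (\<Sum>k\<in>F'. g (b k))"
    using bz F by (auto intro!: sum.mono_neutral_right simp: F'_def)
  define s where "s = (\<Sum>k\<in>F'. b k)"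
  define v where "v = (\<Sum>k\<in>F'. g (b k))"
  have b1: "0 < b k" "b k \<le> 1" if "k \<in> F'" for k
    using that b(2)[of k] a1[of k] by (auto simp: F'_def)
  have "g s \<le> 2 * K * L * v \<and> v \<le> 2 * K * L * g s"
  proof (cases "F' = {}")
    case False
    define n where "n = card F'"
    have n: "0 < n" using False F' by (simp add: n_def card_gt_0_iff)
    obtain e where e: "bij_betw e {..<n} F'" "\<forall>j<n. a (e j) \<le> family_rearr a j"
      using ex_enumeration_le_family_rearr[of a, OF a1 F'] by (auto simp: n_def)
    define b0 where "b0 = b (e 0)"
    have e0: "e 0 \<in> F'" using e(1) n by (auto simp: bij_betw_def)
    have b0: "0 < b0" "b0 \<le> 1" using b1[OF e0] by (auto simp: b0_def)
    \<comment> \<open>The minimum keeps the tail admissible, and it is positive because infinitely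
      many \<open>a k\<close> are. Its sum is at most \<open>b0\<close>, and the sum of its
      \<open>g\<close>-values at most \<open>g b0\<close>; both are already dominated by the member
      \<open>e 0\<close>.\<close>
    define \<tau> where "\<tau> j = (if j < n then b (e j) else min (family_rearr a j) (\<rho> ^ Suc (j - n) * b0))" for j
    have \<tau>0: "0 < \<tau> j" for j
      using family_rearr_pos[of a, OF a1 inf, of j] b0 \<rho>_pos b1[of "e j"] e(1)
      by (auto simp: \<tau>_def bij_betw_def)
    have \<tau>1: "\<tau> j \<le> family_rearr a j" for j
    proof (cases "j < n")
      case True
      then have "e j \<in> F" using e(1) by (auto simp: bij_betw_def F'_def)
      then show ?thesis using True e(2) b(2)[of "e j"] by (force simp: \<tau>_def)
    qed (simp add: \<tau>_def)
    have sm: "summable \<tau>" and t1: "suminf \<tau> \<le> 1"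
      using summable_le_family_rearr[of a \<tau>] suminf_le_family_rearr[of a \<tau>] sum_a \<tau>0 \<tau>1 by auto
    have H: "summable (\<lambda>r. g (\<tau> r))" "g (suminf \<tau>) \<le> K * (\<Sum>r. g (\<tau> r))"
        "(\<Sum>r. g (\<tau> r)) \<le> K * g (suminf \<tau>)"
      using K(2) \<tau>0 \<tau>1 by (auto simp: seq_decomposable_def)
    have init: "(\<Sum>j<n. \<tau> j) = s" "(\<Sum>j<n. g (\<tau> j)) = v"
      unfolding s_def v_def
      by (rule sum.reindex_bij_betw[OF e(1), THEN trans[rotated]], simp add: \<tau>_def)+
    have tl: "\<tau> (j + n) \<le> \<rho> ^ Suc j * b0" for j by (simp add: \<tau>_def)
    have geo: "summable (\<lambda>j. (1/2::real) ^ Suc j * c)" "(\<Sum>j. (1/2::real) ^ Suc j * c) = c" for c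
      using power_half_series[THEN sums_mult2, of c] by (auto simp: sums_iff)
    have "(\<Sum>j. \<tau> (j + n)) \<le> (\<Sum>j. (1/2) ^ Suc j * b0)"
    proof (rule suminf_le)
      fix j
      have "\<rho> ^ Suc j * b0 \<le> (1/2) ^ Suc j * b0"
        using \<rho>_power(2)[of "Suc j"] b0 by (intro mult_right_mono) auto
      then show "\<tau> (j + n) \<le> (1/2) ^ Suc j * b0" using tl[of j] by linarith
    qed (use geo sm in \<open>auto simp: summable_iff_shift\<close>)
    also have "\<dots> = b0" by (rule geo)
    also have "b0 \<le> s" unfolding b0_def s_def using F' e0 b1 by (intro member_le_sum) (auto intro: less_imp_le)
    finally have t2: "suminf \<tau> \<le> 2 * s"
      using suminf_split_initial_segment[OF sm, of n] init by simp
    have t3: "s \<le> suminf \<tau>"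
      using sum_le_suminf[OF sm, of "{..<n}"] \<tau>0 init by (auto intro: less_imp_le)
    have s0: "0 \<le> s" unfolding s_def using b1 by (intro sum_nonneg) (auto intro: less_imp_le)
    have "sum \<tau> {j} \<le> suminf \<tau>" for j
      by (rule sum_le_suminf[OF sm]) (use \<tau>0 in \<open>auto intro: less_imp_le\<close>)
    then have "\<tau> j \<le> 1" for j using t1 by (auto intro: order_trans)
    then have gt0: "0 \<le> g (\<tau> j)" for j using \<tau>0[of j] by (intro nonneg) auto
    have "(\<Sum>j. g (\<tau> (j + n))) \<le> (\<Sum>j. (1/2) ^ Suc j * g b0)"
    proof (rule suminf_le)
      fix j
      have "g (\<tau> (j + n)) \<le> g (\<rho> ^ Suc j * b0)"
        using \<tau>0[of "j + n"] tl[of j] b0 \<rho>_power(3)[of "Suc j"] \<rho>_power(1)[of "Suc j"]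
        by (intro mono mult_le_one) (auto intro: less_imp_le)
      also have "\<dots> \<le> g b0 * (1/2) ^ Suc j" using b0 by (intro decay_power) auto
      finally show "g (\<tau> (j + n)) \<le> (1/2) ^ Suc j * g b0" by (simp add: mult.commute)
    qed (use geo H(1) summable_iff_shift[of "\<lambda>j. g (\<tau> j)" n] in auto)
    also have "\<dots> = g b0" by (rule geo)
    also have "g b0 \<le> v" unfolding b0_def v_def
      using F' e0 b1 by (intro member_le_sum nonneg) (auto intro: less_imp_le)
    finally have v2: "(\<Sum>r. g (\<tau> r)) \<le> 2 * v"
      using suminf_split_initial_segment[OF H(1), of n] init by simp
    have v3: "v \<le> (\<Sum>r. g (\<tau> r))"
      using sum_le_suminf[OF H(1), of "{..<n}"] gt0 init by auto
    have v0: "0 \<le> v" unfolding v_def using b1 by (intro sum_nonneg nonneg) (auto intro: less_imp_le)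
    have "g s \<le> g (suminf \<tau>)" using s0 t3 t1 by (intro mono)
    also have "\<dots> \<le> K * (2 * v)" using H(2) v2 K(1) by (meson mult_left_mono less_imp_le order_trans)
    also have "\<dots> = K * (2 * v) * 1" by simp
    also have "\<dots> \<le> K * (2 * v) * L" using L_ge_1 K(1) v0 by (intro mult_left_mono) auto
    finally have 1: "g s \<le> 2 * K * L * v" by (simp add: mult_ac)
    have "v \<le> K * g (suminf \<tau>)" using v3 H(3) by linarith
    also have "\<dots> \<le> K * (L * g s)"
      using K(1) t1 t2 t3 s0 by (intro mult_left_mono le_L_mult) auto
    also have "\<dots> \<le> 2 * (K * (L * g s))"
      using K(1) L_ge_1 nonneg[of s] s0 t3 t1 by simp
    finally show ?thesis using 1 by (simp add: mult_ac)
  qed (simp add: s_def v_def)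
  then show "g (\<Sum>k\<in>F. b k) \<le> 2 * K * L * (\<Sum>k\<in>F. g (b k))"
    and "(\<Sum>k\<in>F. g (b k)) \<le> 2 * K * L * g (\<Sum>k\<in>F. b k)"
    unfolding sF s_def v_def by auto
qed

end

section \<open>Cutting sets along disjoint levels\<close>

context growth
begin

text \<open>Consider the matrix \<open>b i k\<close> of measures of \<open>T i \<inter> M k\<close>.
  The finite condition applies to each row and to the family of column sums, giving the factor
  \<open>(2 * K * L)\<^sup>2\<close>; the extra \<open>L\<close> pays for keeping finitely many
  levels.\<close>

lemma seq_decomposable_levels:
  fixes M :: "int \<Rightarrow> real set" and T :: "nat \<Rightarrow> real set"
  defines "a \<equiv> \<lambda>k. measure unit_leb (M k)"
  assumes K: "0 < K" "seq_decomposable a K" and inf: "infinite {k. 0 < a k}"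
    and M: "\<And>k. M k \<in> sets unit_leb" "disjoint_family M"
    and I: "finite I" and T: "\<And>i. i \<in> I \<Longrightarrow> T i \<in> sets unit_leb" "\<And>i. i \<in> I \<Longrightarrow> T i \<subseteq> (\<Union>k. M k)"
    and sep: "\<And>i j k. i \<in> I \<Longrightarrow> j \<in> I \<Longrightarrow> i \<noteq> j \<Longrightarrow> T i \<inter> M k = {} \<or> T j \<inter> M k = {}"
  shows "g (measure unit_leb (\<Union>i\<in>I. T i)) \<le> L * (2 * K * L)\<^sup>2 * (\<Sum>i\<in>I. g (measure unit_leb (T i)))"
    and "(\<Sum>i\<in>I. g (measure unit_leb (T i))) \<le> L * (2 * K * L)\<^sup>2 * g (measure unit_leb (\<Union>i\<in>I. T i))"
    and "measure unit_leb (\<Union>i\<in>I. T i) = (\<Sum>i\<in>I. measure unit_leb (T i))"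
proof -
  let ?m = "measure unit_leb"
  define K1 where "K1 = 2 * K * L"
  have K1: "0 < K1" using K(1) L_ge_1 by (simp add: K1_def)
  have sum_a: "(\<Sum>k\<in>F. a k) \<le> 1" if "finite F" for F
    unfolding a_def using M that by (intro sum_measure_disjoint_le_1) (auto simp: disjoint_family_on_def)
  have disjT: "disjoint_family_on T I"
    unfolding disjoint_family_on_def
  proof (intro ballI impI)
    fix i j assume ij: "i \<in> I" "j \<in> I" "i \<noteq> j"
    show "T i \<inter> T j = {}"
    proof (rule ccontr)
      assume "T i \<inter> T j \<noteq> {}"
      then obtain t where t: "t \<in> T i" "t \<in> T j" by auto
      then obtain k where "t \<in> M k" using T(2)[OF ij(1)] by blast
      then show False using t sep[OF ij, of k] by auto
    qed
  qed
  show S: "?m (\<Union>i\<in>I. T i) = (\<Sum>i\<in>I. ?m (T i))"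
    using I T(1) disjT by (intro unit_leb.finite_measure_finite_Union) auto
  \<comment> \<open>By continuity from below, finitely many levels retain half of the measure, which
    is enough for doubling.\<close>
  have ev: "eventually (\<lambda>N. ?m (T i) \<le> 2 * ?m (T i \<inter> (\<Union>k\<in>{-int N..int N}. M k))) sequentially"
    if i: "i \<in> I" for i
  proof (cases "?m (T i) = 0")
    case False
    then have pos: "0 < ?m (T i)" by (simp add: zero_less_measure_iff)
    define A where "A N = T i \<inter> (\<Union>k\<in>{-int N..int N}. M k)" for N
    have "incseq A" unfolding incseq_def A_def by fastforce
    moreover have "range A \<subseteq> sets unit_leb" using T(1)[OF i] M(1) by (auto simp: A_def)
    ultimately have lim: "(\<lambda>N. ?m (A N)) \<longlonglongrightarrow> ?m (\<Union>N. A N)"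
      by (intro unit_leb.finite_Lim_measure_incseq)
    have "(\<Union>N. A N) = T i"
    proof
      show "T i \<subseteq> (\<Union>N. A N)"
      proof
        fix t assume t: "t \<in> T i"
        then obtain k where k: "t \<in> M k" using T(2)[OF i] by blast
        then have "t \<in> A (nat \<bar>k\<bar>)" using t by (auto simp: A_def intro!: bexI[of _ k])
        then show "t \<in> (\<Union>N. A N)" by blast
      qed
    qed (auto simp: A_def)
    with lim have "eventually (\<lambda>N. ?m (T i) / 2 < ?m (A N)) sequentially"
      using pos by (intro order_tendstoD) auto
    then show ?thesis by eventually_elim (simp add: A_def)
  qed simp
  have "eventually (\<lambda>N. \<forall>i\<in>I. ?m (T i) \<le> 2 * ?m (T i \<inter> (\<Union>k\<in>{-int N..int N}. M k))) sequentially"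
    using ev I by (simp add: eventually_ball_finite)
  then obtain N where N: "\<And>i. i \<in> I \<Longrightarrow> ?m (T i) \<le> 2 * ?m (T i \<inter> (\<Union>k\<in>{-int N..int N}. M k))"
    using eventually_happens'[OF sequentially_bot] by blast
  define F where "F = {-int N..int N}"
  define b where "b i k = ?m (T i \<inter> M k)" for i k
  define \<beta> where "\<beta> i = (\<Sum>k\<in>F. b i k)" for i
  have \<beta>_eq: "\<beta> i = ?m (T i \<inter> (\<Union>k\<in>F. M k))" if "i \<in> I" for i
  proof -
    have "?m (\<Union>k\<in>F. T i \<inter> M k) = (\<Sum>k\<in>F. ?m (T i \<inter> M k))"
      using M T(1)[OF that]
      by (intro unit_leb.finite_measure_finite_Union) (auto simp: F_def disjoint_family_on_def)
    then show ?thesis by (simp add: \<beta>_def b_def)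
  qed
  have \<beta>_le: "\<beta> i \<le> ?m (T i)" if "i \<in> I" for i
    unfolding \<beta>_eq[OF that] using T(1)[OF that] by (intro unit_leb.finite_measure_mono) auto
  have le_\<beta>: "?m (T i) \<le> 2 * \<beta> i" if "i \<in> I" for i
    using N[OF that] by (simp add: \<beta>_eq[OF that] F_def)
  have b0: "0 \<le> b i k" for i k by (simp add: b_def)
  have \<beta>0: "0 \<le> \<beta> i" for i unfolding \<beta>_def by (intro sum_nonneg b0)
  have b_le: "b i k \<le> a k" for i k
    unfolding b_def a_def using M by (intro unit_leb.finite_measure_mono) auto
  \<comment> \<open>The only use of separation on the values of \<open>g\<close>: a column has at
    most one nonzero entry and \<open>g 0 = 0\<close>, so \<open>g\<close> commutes exactly with the
    sum over \<open>i\<close>.\<close>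
  have one: "(\<Sum>i\<in>I. b i k) \<le> a k \<and> g (\<Sum>i\<in>I. b i k) = (\<Sum>i\<in>I. g (b i k))" for k
  proof (cases "\<exists>i0\<in>I. T i0 \<inter> M k \<noteq> {}")
    case True
    then obtain i0 where i0: "i0 \<in> I" "T i0 \<inter> M k \<noteq> {}" by auto
    have "b i k = 0" if "i \<in> I - {i0}" for i
      using sep[of i i0 k] that i0 by (auto simp: b_def)
    then have "(\<Sum>i\<in>I. b i k) = b i0 k" "(\<Sum>i\<in>I. g (b i k)) = g (b i0 k)"
      using I i0(1) by (auto simp: sum.remove)
    then show ?thesis using b_le by simp
  next
    case False
    then have "b i k = 0" if "i \<in> I" for i using that by (auto simp: b_def)
    then show ?thesis by (simp add: a_def)
  qed
  have fin: "finite F" by (simp add: F_def)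
  note D = seq_decomposable_finite[OF K inf sum_a fin, folded K1_def]
  have D1: "g (\<Sum>k\<in>F. \<Sum>i\<in>I. b i k) \<le> K1 * (\<Sum>k\<in>F. g (\<Sum>i\<in>I. b i k))"
    "(\<Sum>k\<in>F. g (\<Sum>i\<in>I. b i k)) \<le> K1 * g (\<Sum>k\<in>F. \<Sum>i\<in>I. b i k)"
    using D[of "\<lambda>k. \<Sum>i\<in>I. b i k"] one b0 by (auto simp: sum_nonneg)
  have D2: "g (\<beta> i) \<le> K1 * (\<Sum>k\<in>F. g (b i k))" "(\<Sum>k\<in>F. g (b i k)) \<le> K1 * g (\<beta> i)" for i
    unfolding \<beta>_def using D[of "b i"] b0 b_le by auto
  have sw1: "(\<Sum>k\<in>F. \<Sum>i\<in>I. b i k) = (\<Sum>i\<in>I. \<beta> i)" unfolding \<beta>_def by (rule sum.swap)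
  have sw2: "(\<Sum>k\<in>F. g (\<Sum>i\<in>I. b i k)) = (\<Sum>i\<in>I. \<Sum>k\<in>F. g (b i k))"
    using one by (simp add: sum.swap[of _ I])
  define s where "s = (\<Sum>i\<in>I. ?m (T i))"
  have s: "0 \<le> s" "s \<le> 1" unfolding s_def S[symmetric] by (simp_all add: measure_unit_leb_le_1)
  have \<beta>s: "(\<Sum>i\<in>I. \<beta> i) \<le> s" "s \<le> 2 * (\<Sum>i\<in>I. \<beta> i)"
    unfolding s_def sum_distrib_left by (auto intro!: sum_mono \<beta>_le le_\<beta>)
  have m1: "?m A \<le> 1" for A by (rule measure_unit_leb_le_1)
  have "g s \<le> L * g (\<Sum>i\<in>I. \<beta> i)" using s \<beta>s by (intro le_L_mult) auto
  also have "\<dots> \<le> L * (K1 * (\<Sum>i\<in>I. \<Sum>k\<in>F. g (b i k)))"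
    using L_ge_1 D1(1) unfolding sw1 sw2 by (intro mult_left_mono) auto
  also have "\<dots> \<le> L * (K1 * (\<Sum>i\<in>I. K1 * g (?m (T i))))"
  proof -
    have "(\<Sum>k\<in>F. g (b i k)) \<le> K1 * g (?m (T i))" if "i \<in> I" for i
    proof -
      have "g (\<beta> i) \<le> g (?m (T i))" using \<beta>0 \<beta>_le[OF that] m1 by (intro mono)
      then show ?thesis using D2(2)[of i] K1 by (meson less_imp_le mult_left_mono order_trans)
    qed
    then show ?thesis using L_ge_1 K1 by (intro mult_left_mono sum_mono) auto
  qed
  finally show "g (?m (\<Union>i\<in>I. T i)) \<le> L * (2 * K * L)\<^sup>2 * (\<Sum>i\<in>I. g (?m (T i)))"
    unfolding S s_def[symmetric] K1_def[symmetric]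
    by (simp add: sum_distrib_left power2_eq_square mult.assoc)
  have "(\<Sum>i\<in>I. g (?m (T i))) \<le> (\<Sum>i\<in>I. L * (K1 * (\<Sum>k\<in>F. g (b i k))))"
  proof (rule sum_mono)
    fix i assume i: "i \<in> I"
    have "g (?m (T i)) \<le> L * g (\<beta> i)"
      using le_\<beta>[OF i] \<beta>_le[OF i] m1[of "T i"] by (intro le_L_mult) auto
    also have "\<dots> \<le> L * (K1 * (\<Sum>k\<in>F. g (b i k)))"
      using L_ge_1 D2(1)[of i] by (intro mult_left_mono) auto
    finally show "g (?m (T i)) \<le> L * (K1 * (\<Sum>k\<in>F. g (b i k)))" .
  qed
  also have "\<dots> = L * (K1 * (\<Sum>k\<in>F. g (\<Sum>i\<in>I. b i k)))" by (simp add: sw2 sum_distrib_left)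
  also have "\<dots> \<le> L * (K1 * (K1 * g (\<Sum>i\<in>I. \<beta> i)))"
    using L_ge_1 K1 D1(2) unfolding sw1 by (intro mult_left_mono) auto
  also have "\<dots> \<le> L * (K1 * (K1 * g s))"
    using L_ge_1 K1 \<beta>s s \<beta>0 by (intro mult_left_mono mono sum_nonneg) auto
  finally show "(\<Sum>i\<in>I. g (?m (T i))) \<le> L * (2 * K * L)\<^sup>2 * g (?m (\<Union>i\<in>I. T i))"
    unfolding S s_def[symmetric] K1_def[symmetric] by (simp add: power2_eq_square mult.assoc)
qed

end

section \<open>Separated supports\<close>

text \<open>The supremum is attained along a sequence of lower bounds, so only countably many null
  sets have to be discarded.\<close>

lemma essinf_AE: "AE t in M. essinf M f \<le> f t"
proof -
  define A where "A = {z. AE t in M. z \<le> f t}"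
  have "- \<infinity> \<in> A" by (simp add: A_def)
  then obtain u :: "nat \<Rightarrow> ereal" where u: "range u \<subseteq> A" "Sup A = (SUP n. u n)"
    using Sup_countable_SUP[of A] by auto
  have "AE t in M. \<forall>n. u n \<le> f t"
    using u(1) by (auto simp: AE_all_countable A_def)
  then show ?thesis
    unfolding essinf_def A_def[symmetric] u(2) by eventually_elim (auto intro: SUP_least)
qed

lemma supp_sets:
  assumes "x \<in> borel_measurable unit_leb"
  shows "supp x \<in> sets lebesgue"
proof -
  have "{t \<in> space unit_leb. x t \<noteq> 0} \<in> sets unit_leb"
    using assms by measurable
  then show ?thesis by (simp add: supp_def sets_restrict_space_iff)
qed

text \<open>Turns essential bounds for consecutive supports into pointwise ones for all pairs. One
  null set serves the \<open>x i\<close> and the \<open>y i\<close> together.\<close>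

lemma ex_separating_null_set:
  fixes x y :: "nat \<Rightarrow> real \<Rightarrow> real"
  assumes w: "weight w"
    and xy: "\<And>i. i \<in> {1..n} \<Longrightarrow> x i \<in> borel_measurable unit_leb \<and> y i \<in> borel_measurable unit_leb \<and>
        \<not> (AE t in unit_leb. x i t = 0)"
    and sep: "\<And>i. i \<in> {1..<n} \<Longrightarrow>
        essinf (lebesgue_on (supp (x i) \<union> supp (y i))) (\<lambda>t. ereal (w t))
          \<ge> 2 * esssup (lebesgue_on (supp (x (i + 1)) \<union> supp (y (i + 1)))) (\<lambda>t. ereal (w t))"
  shows "\<exists>Z. Z \<in> null_sets lebesgue \<and> (\<forall>t\<in>{0..1} - Z. 0 < w t) \<and>
    (\<forall>i\<in>{1..n}. \<forall>j\<in>{1..n}. i < j \<longrightarrow>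
      (\<forall>s\<in>supp (x i) \<union> supp (y i) - Z. \<forall>t\<in>supp (x j) \<union> supp (y j) - Z. 2 * w t \<le> w s))"
proof -
  define S where "S i = supp (x i) \<union> supp (y i)" for i
  define I where "I i = essinf (lebesgue_on (S i)) (\<lambda>t. ereal (w t))" for i
  define U where "U i = esssup (lebesgue_on (S i)) (\<lambda>t. ereal (w t))" for i
  have "AE t in lebesgue. t \<in> S i \<longrightarrow> I i \<le> ereal (w t) \<and> ereal (w t) \<le> U i" if "i \<in> {1..n}" for i
  proof -
    have "S i \<in> sets lebesgue" using xy[OF that] by (auto simp: S_def intro!: sets.Un supp_sets)
    moreover have "AE t in lebesgue_on (S i). I i \<le> ereal (w t) \<and> ereal (w t) \<le> U i"
      unfolding I_def U_def AE_conj_iff by (intro conjI essinf_AE esssup_AE)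
    ultimately show ?thesis by (subst (asm) AE_restrict_space_iff) auto
  qed
  then have "AE t in lebesgue. \<forall>i\<in>{1..n}. t \<in> S i \<longrightarrow> I i \<le> ereal (w t) \<and> ereal (w t) \<le> U i"
    by (intro AE_finite_allI) auto
  moreover have "AE t in lebesgue. t \<in> {0..1} \<longrightarrow> 0 < w t"
    using w by (auto simp: weight_def AE_restrict_space_iff)
  ultimately have "AE t in lebesgue. (\<forall>i\<in>{1..n}. t \<in> S i \<longrightarrow> I i \<le> ereal (w t) \<and> ereal (w t) \<le> U i)
      \<and> (t \<in> {0..1} \<longrightarrow> 0 < w t)" by eventually_elim auto
  then obtain Z where Z: "Z \<in> null_sets lebesgue"
      "{t. \<not> ((\<forall>i\<in>{1..n}. t \<in> S i \<longrightarrow> I i \<le> ereal (w t) \<and> ereal (w t) \<le> U i) \<and> (t \<in> {0..1} \<longrightarrow> 0 < w t))} \<subseteq> Z"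
    by (auto simp: eventually_ae_filter)
  have ZIU: "I i \<le> ereal (w t)" "ereal (w t) \<le> U i" if "i \<in> {1..n}" "t \<in> S i - Z" for i t
    using Z(2) that by blast+
  have Zw: "0 < w t" if "t \<in> {0..1} - Z" for t using Z(2) that by blast
  \<comment> \<open>Since \<open>x i\<close> is not null, its support has a point outside
    \<open>Z\<close>, and the value of \<open>w\<close> there lies between the two bounds.\<close>
  have IU: "I i \<le> U i" "0 \<le> U i" if i: "i \<in> {1..n}" for i
  proof -
    have "\<not> supp (x i) \<subseteq> Z"
    proof
      assume "supp (x i) \<subseteq> Z"
      then have "AE t in lebesgue. t \<in> {0..1} \<longrightarrow> x i t = 0"
        using Z(1) by (intro AE_I'[of Z]) (auto simp: supp_def)
      then show False using xy[OF i] by (simp add: AE_restrict_space_iff)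
    qed
    then obtain t where t: "t \<in> supp (x i)" "t \<notin> Z" by auto
    then have "I i \<le> ereal (w t)" "ereal (w t) \<le> U i" "0 < w t"
      using ZIU[OF i, of t] Zw[of t] by (auto simp: S_def supp_def)
    then show "I i \<le> U i" "0 \<le> U i" by (auto intro: order_trans[of _ "ereal (w t)"])
  qed
  \<comment> \<open>The induction step passes through
    \<open>2 * U (Suc j) \<le> I j \<le> U j \<le> 2 * U j\<close>; the last inequality uses
    \<open>0 \<le> U j\<close>.\<close>
  have chain: "2 * U j \<le> I i" if "i < j" "1 \<le> i" "j \<le> n" for i j
    using that
  proof (induction j)
    case (Suc j)
    have hyp: "2 * U (Suc j) \<le> I j" if "1 \<le> j"
      using sep[of j] Suc.prems that by (simp add: I_def U_def S_def)
    show ?case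
    proof (cases "i = j")
      case False
      then have ij: "i < j" using Suc.prems by simp
      have "2 * U (Suc j) \<le> U j" using hyp IU(1)[of j] Suc.prems ij by (auto intro: order_trans)
      also have "U j \<le> 2 * U j"
        using IU(2)[of j] Suc.prems ij ereal_mult_right_mono[of 1 2 "U j"] by simp
      also have "\<dots> \<le> I i" using Suc ij by simp
      finally show ?thesis .
    qed (use hyp Suc.prems in auto)
  qed simp
  have "2 * w t \<le> w s" if ij: "i \<in> {1..n}" "j \<in> {1..n}" "i < j" and st: "s \<in> S i - Z" "t \<in> S j - Z" for i j s t
  proof -
    have "ereal (2 * w t) = 2 * ereal (w t)" by simp
    also have "\<dots> \<le> 2 * U j" using ZIU(2)[OF ij(2) st(2)] by (intro ereal_mult_left_mono) auto
    also have "\<dots> \<le> I i" using ij by (intro chain) auto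
    also have "\<dots> \<le> ereal (w s)" by (rule ZIU(1)[OF ij(1) st(1)])
    finally show ?thesis by simp
  qed
  then show ?thesis using Z(1) Zw unfolding S_def by (intro exI[of _ Z]) blast
qed

lemma less_abs_sum_iff:
  fixes x :: "'i \<Rightarrow> real"
  assumes "finite I" "0 \<le> c" and uniq: "\<And>i j. i \<in> I \<Longrightarrow> j \<in> I \<Longrightarrow> x i \<noteq> 0 \<Longrightarrow> x j \<noteq> 0 \<Longrightarrow> i = j"
  shows "c < \<bar>\<Sum>i\<in>I. x i\<bar> \<longleftrightarrow> (\<exists>i\<in>I. c < \<bar>x i\<bar>)"
proof (cases "\<exists>i\<in>I. x i \<noteq> 0")
  case True
  then obtain i where i: "i \<in> I" "x i \<noteq> 0" by auto
  have z: "x j = 0" if "j \<in> I - {i}" for j using uniq[of j i] that i by auto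
  have "(\<Sum>i\<in>I. x i) = x i" using assms(1) i(1) z by (simp add: sum.remove)
  then show ?thesis using i(1) z assms(2) by (metis Diff_iff abs_zero empty_iff insert_iff not_less)
qed (use assms in auto)

lemma dyadic_level_sets:
  assumes "w \<in> borel_measurable unit_leb"
  shows "dyadic_level w k \<in> sets unit_leb"
proof -
  have "{t \<in> space unit_leb. 2 powi k \<le> w t \<and> w t < 2 powi (k + 1)} \<in> sets unit_leb"
    using assms by measurable
  then show ?thesis by (simp add: dyadic_level_def)
qed

lemma powi_2_Suc: "(2::real) powi (k + 1) = 2 * 2 powi k"
  by (simp add: power_int_add)

lemma powi_2_mono: "k \<le> l \<Longrightarrow> (2::real) powi k \<le> 2 powi l"
  by (intro power_int_increasing) auto

lemma disjoint_dyadic_level: "disjoint_family (dyadic_level w)"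
proof -
  have "dyadic_level w k \<inter> dyadic_level w l = {}" if "k < l" for k l
    using powi_2_mono[of "k + 1" l] that by (auto simp: dyadic_level_def)
  then show ?thesis unfolding disjoint_family_on_def by (metis Int_commute linorder_neqE)
qed

lemma sum_dyadic_level_le_1:
  assumes "w \<in> borel_measurable unit_leb" "finite F"
  shows "(\<Sum>k\<in>F. measure unit_leb (dyadic_level w k)) \<le> 1"
  using assms disjoint_dyadic_level[of w]
  by (intro sum_measure_disjoint_le_1 dyadic_level_sets) (auto simp: disjoint_family_on_def)

lemma ex_dyadic_level:
  assumes "t \<in> {0..1}" "0 < w t"
  shows "\<exists>k. t \<in> dyadic_level w k"
proof -
  define k where "k = \<lfloor>log 2 (w t)\<rfloor>"
  have "2 powr real_of_int k \<le> 2 powr (log 2 (w t))" "2 powr (log 2 (w t)) < 2 powr real_of_int (k + 1)"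
    unfolding k_def by (intro powr_mono powr_less_mono; linarith)+
  moreover have "(2::real) powr real_of_int m = 2 powi m" for m by (simp add: powr_real_of_int')
  ultimately have "2 powi k \<le> w t \<and> w t < 2 powi (k + 1)" using assms by (simp only: powr_log_cancel)
  then have "t \<in> dyadic_level w k" using assms by (simp add: dyadic_level_def)
  then show ?thesis ..
qed

text \<open>With finitely many levels of positive measure, their indices are bounded by some
  \<open>B\<close>, and then both \<open>w\<close> and \<open>1 / w\<close> are essentially
  bounded.\<close>

lemma infinite_dyadic_levels:
  assumes w: "nontrivial_weight w"
  shows "infinite {k. 0 < measure unit_leb (dyadic_level w k)}"
proof
  define S where "S = {k. 0 < measure unit_leb (dyadic_level w k)}"
  assume "finite {k. 0 < measure unit_leb (dyadic_level w k)}"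
  then have "finite (abs ` S)" by (simp add: S_def)
  then obtain B where B: "\<And>k. k \<in> S \<Longrightarrow> \<bar>k\<bar> \<le> B"
    using bdd_above_finite by (fastforce simp: bdd_above_def)
  have wm: "w \<in> borel_measurable unit_leb" "AE t in unit_leb. 0 < w t"
    using w by (auto simp: nontrivial_weight_def weight_def)
  have "AE t in unit_leb. t \<notin> dyadic_level w k" if "k \<notin> S" for k
  proof (rule AE_not_in)
    have "measure unit_leb (dyadic_level w k) = 0" using that by (simp add: S_def not_less order.antisym)
    then show "dyadic_level w k \<in> null_sets unit_leb"
      using dyadic_level_sets[OF wm(1)] by (auto simp: null_sets_def unit_leb.emeasure_eq_measure)
  qed
  then have "AE t in unit_leb. \<forall>k. k \<notin> S \<longrightarrow> t \<notin> dyadic_level w k"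
    by (auto simp: AE_all_countable)
  then have AE: "AE t in unit_leb. w t \<le> 2 powi (B + 1) \<and> 1 / w t \<le> 2 powi B"
    using wm(2) AE_space
  proof eventually_elim
    case (elim t)
    then obtain k where k: "t \<in> dyadic_level w k" using ex_dyadic_level[of t w] by auto
    then have "k \<in> S" using elim by blast
    then have "2 powi (k + 1) \<le> (2::real) powi (B + 1)" "2 powi (- B) \<le> (2::real) powi k"
      using B[of k] by (auto intro!: powi_2_mono)
    with k have "w t \<le> 2 powi (B + 1)" "2 powi (- B) \<le> w t" by (auto simp: dyadic_level_def)
    moreover have "1 / w t \<le> 1 / 2 powi (- B)" using calculation(2) by (intro divide_left_mono) (use elim in auto)
    ultimately show ?case by (simp add: power_int_minus divide_inverse)
  qed
  show False using w AE by (auto simp: nontrivial_weight_def)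
qed

lemma distr_fun_eq_measure_diff_null:
  assumes "x \<in> borel_measurable unit_leb" "Z \<in> null_sets lebesgue"
  shows "{s \<in> {0..1} - Z. \<bar>x s\<bar> > c} \<in> sets unit_leb"
    and "distr_fun x c = measure unit_leb {s \<in> {0..1} - Z. \<bar>x s\<bar> > c}"
proof -
  have Z: "Z \<inter> {0..1} \<in> null_sets unit_leb"
    using assms(2) by (auto simp: null_sets_restrict_space intro: null_set_Int2)
  have eq: "{s \<in> {0..1} - Z. \<bar>x s\<bar> > c} = {s \<in> {0..1}. \<bar>x s\<bar> > c} - Z \<inter> {0..1}" by auto
  show "{s \<in> {0..1} - Z. \<bar>x s\<bar> > c} \<in> sets unit_leb"
    unfolding eq using superlevel_sets[OF assms(1)] Z by auto
  show "distr_fun x c = measure unit_leb {s \<in> {0..1} - Z. \<bar>x s\<bar> > c}"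
    unfolding eq distr_fun_def
    using measure_Diff_null_set[OF superlevel_sets[OF assms(1)] Z] by simp
qed

section \<open>Sums of functions with separated supports\<close>

context lorentz_growth
begin

text \<open>At each height the superlevel set of the sum is, off \<open>Z\<close>, the disjoint
  union of those of the summands, and no level meets two of them. Hence
  \<open>seq_decomposable_levels\<close> compares the values of \<open>g\<close> height by
  height.\<close>

lemma lorentz_modular_sum_separated:
  assumes w: "nontrivial_weight w" and K: "0 < K"
      "seq_decomposable (\<lambda>k. measure unit_leb (dyadic_level w k)) K"
    and I: "finite I" and x: "\<And>i. i \<in> I \<Longrightarrow> x i \<in> borel_measurable unit_leb"
    and Z: "Z \<in> null_sets lebesgue" "\<And>t. t \<in> {0..1} - Z \<Longrightarrow> 0 < w t"
    and sep: "\<And>i j s t. i \<in> I \<Longrightarrow> j \<in> I \<Longrightarrow> i < (j::nat) \<Longrightarrow> s \<in> supp (x i) - Z \<Longrightarrow> t \<in> supp (x j) - Z \<Longrightarrow>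
        2 * w t \<le> w s"
  shows "lorentz_modular p \<phi> (\<lambda>t. \<Sum>i\<in>I. x i t) \<le>
      ennreal (L * (2 * K * L)\<^sup>2 * modular_const) * (\<Sum>i\<in>I. lorentz_modular p \<phi> (x i))"
    and "(\<Sum>i\<in>I. lorentz_modular p \<phi> (x i)) \<le>
      ennreal (L * (2 * K * L)\<^sup>2 * modular_const) * lorentz_modular p \<phi> (\<lambda>t. \<Sum>i\<in>I. x i t)"
proof -
  define X where "X t = (\<Sum>i\<in>I. x i t)" for t
  have XX: "(\<lambda>t. \<Sum>i\<in>I. x i t) = X" by (simp add: X_def fun_eq_iff)
  have X: "X \<in> borel_measurable unit_leb" unfolding X_def using x by (rule borel_measurable_sum)
  have wm: "w \<in> borel_measurable unit_leb" using w by (simp add: nontrivial_weight_def weight_def)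
  have K2: "0 \<le> L * (2 * K * L)\<^sup>2" using L_ge_1 by simp
  have *: "g (distr_fun X c) \<le> L * (2 * K * L)\<^sup>2 * (\<Sum>i\<in>I. g (distr_fun (x i) c)) \<and>
      (\<Sum>i\<in>I. g (distr_fun (x i) c)) \<le> L * (2 * K * L)\<^sup>2 * g (distr_fun X c)" if c: "0 < c" for c
  proof -
    define T where "T i = {s \<in> {0..1} - Z. \<bar>x i s\<bar> > c}" for i
    have T: "T i \<in> sets unit_leb" "distr_fun (x i) c = measure unit_leb (T i)" if "i \<in> I" for i
      unfolding T_def using distr_fun_eq_measure_diff_null[OF x[OF that] Z(1), of c] by auto
    have Tsupp: "T i \<subseteq> supp (x i) - Z" for i using c by (auto simp: T_def supp_def)
    \<comment> \<open>A common point would satisfy \<open>2 * w s \<le> w s\<close>, contradicting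
      \<open>0 < w s\<close>.\<close>
    have uniq: "i = j" if "i \<in> I" "j \<in> I" "s \<in> supp (x i) - Z" "s \<in> supp (x j) - Z" for i j s
      using sep[of i j s s] sep[of j i s s] that Z(2)[of s]
      by (cases i j rule: linorder_cases) (auto simp: supp_def)
    have "{s \<in> {0..1} - Z. \<bar>X s\<bar> > c} = (\<Union>i\<in>I. T i)"
    proof (intro set_eqI)
      fix s
      have "\<bar>X s\<bar> > c \<longleftrightarrow> (\<exists>i\<in>I. \<bar>x i s\<bar> > c)" if "s \<in> {0..1} - Z"
        unfolding X_def using I c uniq that by (intro less_abs_sum_iff) (auto simp: supp_def)
      then show "s \<in> {s \<in> {0..1} - Z. \<bar>X s\<bar> > c} \<longleftrightarrow> s \<in> (\<Union>i\<in>I. T i)" by (auto simp: T_def)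
    qed
    then have XT: "distr_fun X c = measure unit_leb (\<Union>i\<in>I. T i)"
      using distr_fun_eq_measure_diff_null(2)[OF X Z(1), of c] by simp
    \<comment> \<open>Two values of \<open>w\<close> in one level have ratio strictly below
      2.\<close>
    have sepT: "T i \<inter> dyadic_level w k = {} \<or> T j \<inter> dyadic_level w k = {}"
      if "i \<in> I" "j \<in> I" "i < j" for i j k
    proof (rule ccontr)
      assume "\<not> ?thesis"
      then obtain s t where st: "s \<in> T i" "s \<in> dyadic_level w k" "t \<in> T j" "t \<in> dyadic_level w k" by auto
      then have "2 * w t \<le> w s" using sep[OF that, of s t] Tsupp by auto
      then show False using st(2,4) powi_2_Suc[of k] by (auto simp: dyadic_level_def)
    qed
    have cover: "T i \<subseteq> (\<Union>k. dyadic_level w k)" for i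
    proof
      fix t assume "t \<in> T i"
      then have "t \<in> {0..1}" "0 < w t" using Z(2)[of t] by (auto simp: T_def)
      then show "t \<in> (\<Union>k. dyadic_level w k)" using ex_dyadic_level by auto
    qed
    note lev = seq_decomposable_levels[where M = "dyadic_level w" and T = T and I = I,
        OF K infinite_dyadic_levels[OF w] dyadic_level_sets[OF wm] disjoint_dyadic_level I T(1) cover]
    have "T i \<inter> dyadic_level w k = {} \<or> T j \<inter> dyadic_level w k = {}"
      if "i \<in> I" "j \<in> I" "i \<noteq> j" for i j k
      using sepT[of i j k] sepT[of j i k] that by (cases "i < j") auto
    then show ?thesis using lev(1,2) unfolding XT by (simp add: T(2))
  qed
  show "lorentz_modular p \<phi> (\<lambda>t. \<Sum>i\<in>I. x i t) \<le>
      ennreal (L * (2 * K * L)\<^sup>2 * modular_const) * (\<Sum>i\<in>I. lorentz_modular p \<phi> (x i))"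
    using sum_lorentz_modular_le[of _ "{()}" I "\<lambda>_. X" x, OF K2 _ I] X x * by (simp add: XX)
  show "(\<Sum>i\<in>I. lorentz_modular p \<phi> (x i)) \<le>
      ennreal (L * (2 * K * L)\<^sup>2 * modular_const) * lorentz_modular p \<phi> (\<lambda>t. \<Sum>i\<in>I. x i t)"
    using sum_lorentz_modular_le[of _ I "{()}" x "\<lambda>_. X", OF K2 I] X x * by (simp add: XX)
qed

lemma lorentz_norm_le:
  assumes "0 \<le> B" "lorentz_modular p \<phi> u \<le> ennreal B * lorentz_modular p \<phi> v"
    and "lorentz_modular p \<phi> v < \<infinity>"
  shows "lorentz_norm p \<phi> u \<le> B powr (1 / p) * lorentz_norm p \<phi> v"
proof -
  have "enn2real (lorentz_modular p \<phi> u) \<le> enn2real (ennreal B * lorentz_modular p \<phi> v)"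
    using assms by (intro enn2real_mono) (auto simp: ennreal_mult_less_top)
  also have "\<dots> = B * enn2real (lorentz_modular p \<phi> v)" using assms by (simp add: enn2real_mult)
  finally show ?thesis
    unfolding lorentz_norm_def using assms p by (simp add: powr_mult[symmetric] powr_mono2)
qed

lemma lorentz_modular_eq_of_norm_eq:
  assumes "lorentz_norm p \<phi> u = lorentz_norm p \<phi> v"
    and "lorentz_modular p \<phi> u < \<infinity>" "lorentz_modular p \<phi> v < \<infinity>"
  shows "lorentz_modular p \<phi> u = lorentz_modular p \<phi> v"
proof -
  have eq: "enn2real (lorentz_modular p \<phi> z) = lorentz_norm p \<phi> z powr p" for z
    using p by (simp add: lorentz_norm_def powr_powr)
  have "enn2real (lorentz_modular p \<phi> u) = enn2real (lorentz_modular p \<phi> v)"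
    unfolding eq assms(1) ..
  then show ?thesis using assms(2,3) by (metis ennreal_enn2real infinity_ennreal_def)
qed

lemma w_decomposable_if_seq_decomposable:
  assumes w: "nontrivial_weight w" and K: "0 < K"
      "seq_decomposable (\<lambda>k. measure unit_leb (dyadic_level w k)) K"
  shows "w_decomposable w (lorentz_space p \<phi>) (lorentz_norm p \<phi>)"
proof -
  define B where "B = L * (2 * K * L)\<^sup>2 * modular_const"
  have B: "0 < B" using L_ge_1 K(1) modular_const_pos by (simp add: B_def)
  \<comment> \<open>One factor \<open>B\<close> leads from the sum of the \<open>x i\<close> to the
    common sum of modulars, the other from there to the sum of the \<open>y i\<close>.\<close>
  define C where "C = (B * B) powr (1 / p)"
  have C: "0 < C" using B by (simp add: C_def)
  have "inverse C * lorentz_norm p \<phi> (\<lambda>t. \<Sum>i=1..n. x i t) \<le> lorentz_norm p \<phi> (\<lambda>t. \<Sum>i=1..n. y i t) \<and>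
      lorentz_norm p \<phi> (\<lambda>t. \<Sum>i=1..n. y i t) \<le> C * lorentz_norm p \<phi> (\<lambda>t. \<Sum>i=1..n. x i t)"
    if xy: "\<forall>i\<in>{1..n}. x i \<in> lorentz_space p \<phi> \<and> y i \<in> lorentz_space p \<phi> \<and>
           \<not> (AE t in unit_leb. x i t = 0) \<and> \<not> (AE t in unit_leb. y i t = 0) \<and>
           lorentz_norm p \<phi> (x i) = lorentz_norm p \<phi> (y i)"
      and sep: "\<forall>i\<in>{1..<n}.
           essinf (lebesgue_on (supp (x i) \<union> supp (y i))) (\<lambda>t. ereal (w t))
             \<ge> 2 * esssup (lebesgue_on (supp (x (i + 1)) \<union> supp (y (i + 1)))) (\<lambda>t. ereal (w t))"
    for n and x y :: "nat \<Rightarrow> real \<Rightarrow> real"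
  proof -
    have mx: "x i \<in> borel_measurable unit_leb" "lorentz_modular p \<phi> (x i) < \<infinity>"
      and my: "y i \<in> borel_measurable unit_leb" "lorentz_modular p \<phi> (y i) < \<infinity>" if "i \<in> {1..n}" for i
      using xy that by (auto simp: lorentz_space_def)
    have eq: "(\<Sum>i\<in>{1..n}. lorentz_modular p \<phi> (x i)) = (\<Sum>i\<in>{1..n}. lorentz_modular p \<phi> (y i))"
      using xy mx my by (intro sum.cong refl lorentz_modular_eq_of_norm_eq) auto
    have "weight w" using w by (simp add: nontrivial_weight_def)
    then have "\<exists>Z. Z \<in> null_sets lebesgue \<and> (\<forall>t\<in>{0..1} - Z. 0 < w t) \<and>
        (\<forall>i\<in>{1..n}. \<forall>j\<in>{1..n}. i < j \<longrightarrow>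
          (\<forall>s\<in>supp (x i) \<union> supp (y i) - Z. \<forall>t\<in>supp (x j) \<union> supp (y j) - Z. 2 * w t \<le> w s))"
    proof (rule ex_separating_null_set)
      show "x i \<in> borel_measurable unit_leb \<and> y i \<in> borel_measurable unit_leb \<and>
        \<not> (AE t in unit_leb. x i t = 0)" if "i \<in> {1..n}" for i
        using xy mx(1)[OF that] my(1)[OF that] that by blast
    qed (use sep in blast)
    then obtain Z where Z: "Z \<in> null_sets lebesgue" "\<And>t. t \<in> {0..1} - Z \<Longrightarrow> 0 < w t"
      "\<And>i j s t. i \<in> {1..n} \<Longrightarrow> j \<in> {1..n} \<Longrightarrow> i < j \<Longrightarrow>
        s \<in> supp (x i) \<union> supp (y i) - Z \<Longrightarrow> t \<in> supp (x j) \<union> supp (y j) - Z \<Longrightarrow> 2 * w t \<le> w s"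
      by (elim exE conjE) metis
    note S = lorentz_modular_sum_separated[OF w K finite_atLeastAtMost[of 1 n] _ Z(1), folded B_def]
    have sepx: "2 * w t \<le> w s"
      if "i \<in> {1..n}" "j \<in> {1..n}" "i < j" "s \<in> supp (x i) - Z" "t \<in> supp (x j) - Z" for i j s t
      using Z(3)[OF that(1-3)] that(4,5) by simp
    have sepy: "2 * w t \<le> w s"
      if "i \<in> {1..n}" "j \<in> {1..n}" "i < j" "s \<in> supp (y i) - Z" "t \<in> supp (y j) - Z" for i j s t
      using Z(3)[OF that(1-3)] that(4,5) by simp
    have Sx: "lorentz_modular p \<phi> (\<lambda>t. \<Sum>i=1..n. x i t) \<le> ennreal B * (\<Sum>i\<in>{1..n}. lorentz_modular p \<phi> (x i))"
      "(\<Sum>i\<in>{1..n}. lorentz_modular p \<phi> (x i)) \<le> ennreal B * lorentz_modular p \<phi> (\<lambda>t. \<Sum>i=1..n. x i t)"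
      by (rule S; fact mx(1) Z(2) sepx)+
    have Sy: "lorentz_modular p \<phi> (\<lambda>t. \<Sum>i=1..n. y i t) \<le> ennreal B * (\<Sum>i\<in>{1..n}. lorentz_modular p \<phi> (y i))"
      "(\<Sum>i\<in>{1..n}. lorentz_modular p \<phi> (y i)) \<le> ennreal B * lorentz_modular p \<phi> (\<lambda>t. \<Sum>i=1..n. y i t)"
      by (rule S; fact my(1) Z(2) sepy)+
    have fin: "lorentz_modular p \<phi> (\<lambda>t. \<Sum>i=1..n. x i t) < \<infinity>" "lorentz_modular p \<phi> (\<lambda>t. \<Sum>i=1..n. y i t) < \<infinity>"
      by (rule le_less_trans[OF Sx(1)] le_less_trans[OF Sy(1)];
          use mx(2) my(2) in \<open>simp add: ennreal_mult_less_top\<close>)+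
    have BB: "ennreal (B * B) = ennreal B * ennreal B" using B by (simp add: ennreal_mult)
    have "lorentz_modular p \<phi> (\<lambda>t. \<Sum>i=1..n. x i t) \<le> ennreal (B * B) * lorentz_modular p \<phi> (\<lambda>t. \<Sum>i=1..n. y i t)"
      unfolding BB mult.assoc using Sx(1) Sy(2) unfolding eq
      by (meson mult_left_mono order_trans zero_le)
    then have 1: "lorentz_norm p \<phi> (\<lambda>t. \<Sum>i=1..n. x i t) \<le> C * lorentz_norm p \<phi> (\<lambda>t. \<Sum>i=1..n. y i t)"
      unfolding C_def using B fin by (intro lorentz_norm_le) auto
    have "lorentz_modular p \<phi> (\<lambda>t. \<Sum>i=1..n. y i t) \<le> ennreal (B * B) * lorentz_modular p \<phi> (\<lambda>t. \<Sum>i=1..n. x i t)"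
      unfolding BB mult.assoc using Sy(1) Sx(2) unfolding eq
      by (meson mult_left_mono order_trans zero_le)
    then have 2: "lorentz_norm p \<phi> (\<lambda>t. \<Sum>i=1..n. y i t) \<le> C * lorentz_norm p \<phi> (\<lambda>t. \<Sum>i=1..n. x i t)"
      unfolding C_def using B fin by (intro lorentz_norm_le) auto
    show ?thesis using 1 2 C by (simp add: field_simps)
  qed
  then show ?thesis unfolding w_decomposable_def using C by blast
qed

end

section \<open>From decomposability to the sequence condition\<close>

text \<open>The measure of \<open>A \<inter> {0..u}\<close> is 1-Lipschitz in \<open>u\<close>, so
  the intermediate value theorem yields the cut.\<close>

lemma ex_subset_measure_eq:
  assumes A: "A \<in> sets unit_leb" and s: "0 \<le> s" "s \<le> measure unit_leb A"
  shows "\<exists>E\<in>sets unit_leb. E \<subseteq> A \<and> measure unit_leb E = s"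
proof -
  define f where "f u = measure unit_leb (A \<inter> {0..u})" for u
  have A01: "A \<subseteq> {0..1}" using sets.sets_into_space[OF A] by simp
  have AI: "A \<inter> B \<in> sets unit_leb" if "B \<in> sets borel" for B
  proof -
    have "B \<in> sets lebesgue" using that by (simp add: sets_completionI_sets)
    then show ?thesis using A A01 by (auto simp: sets_restrict_space_iff)
  qed
  have step: "f u \<le> f v \<and> f v - f u \<le> v - u" if "0 \<le> u" "u \<le> v" "v \<le> 1" for u v
  proof -
    have "f v = measure unit_leb ((A \<inter> {0..u}) \<union> (A \<inter> {u<..v}))"
      unfolding f_def using that by (intro arg_cong[of _ _ "measure unit_leb"]) auto
    also have "\<dots> = f u + measure unit_leb (A \<inter> {u<..v})"
      unfolding f_def by (intro unit_leb.finite_measure_Union AI) auto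
    finally have eq: "f v = f u + measure unit_leb (A \<inter> {u<..v})" .
    have "measure unit_leb (A \<inter> {u<..v}) \<le> measure unit_leb {u<..v}"
      using that by (intro unit_leb.finite_measure_mono) (auto simp: sets_restrict_space_iff)
    also have "\<dots> = v - u" using that by (subst measure_restrict_space) auto
    finally show ?thesis using eq by simp
  qed
  have "1-lipschitz_on {0..1} f"
  proof (rule lipschitz_onI)
    fix u v :: real assume "u \<in> {0..1}" "v \<in> {0..1}"
    then show "dist (f u) (f v) \<le> 1 * dist u v"
      using step[of u v] step[of v u] by (cases "u \<le> v") (auto simp: dist_real_def)
  qed simp
  then have "continuous_on {0..1} f" by (rule lipschitz_on_continuous_on)
  moreover have "f 0 \<le> s"
  proof -
    have "f 0 \<le> measure unit_leb {0}"
      unfolding f_def by (intro unit_leb.finite_measure_mono) (auto simp: sets_restrict_space_iff)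
    also have "\<dots> = 0" by (subst measure_restrict_space) auto
    finally show ?thesis using s by simp
  qed
  moreover have "s \<le> f 1" using s A01 by (simp add: f_def Int_absorb2)
  ultimately obtain u where "f u = s" using IVT'[of f 0 s 1] by auto
  then show ?thesis unfolding f_def using AI by (intro bexI[of _ "A \<inter> {0..u}"]) auto
qed

lemma not_AE_indicator_eq_0:
  fixes b :: real
  assumes E: "E \<in> sets unit_leb" "0 < measure unit_leb E" and "b \<noteq> 0"
  shows "\<not> (AE t in unit_leb. b * indicator E t = 0)"
proof
  assume "AE t in unit_leb. b * indicator E t = 0"
  then have "AE t in unit_leb. t \<notin> E"
    by eventually_elim (use \<open>b \<noteq> 0\<close> in \<open>auto simp: indicator_def split: if_splits\<close>)
  then have "E \<in> null_sets unit_leb" using AE_iff_null_sets[OF E(1)] by simp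
  then show False using E(2) by (simp add: null_sets_def measure_def)
qed

text \<open>On the lower level \<open>w\<close> is below \<open>2 powi (l + 1)\<close>, so twice its
  supremum is at most \<open>2 powi (l + 2)\<close>: a gap of two indices is what this bound
  needs.\<close>

lemma separated_dyadic_levels:
  assumes w: "w \<in> borel_measurable unit_leb"
    and S: "S \<subseteq> dyadic_level w k" and T: "T \<subseteq> dyadic_level w l" and "l + 2 \<le> k"
  shows "2 * esssup (lebesgue_on T) (\<lambda>t. ereal (w t)) \<le> essinf (lebesgue_on S) (\<lambda>t. ereal (w t))"
proof -
  have "T \<subseteq> {0..1}" using T by (auto simp: dyadic_level_def)
  then have "w \<in> borel_measurable (lebesgue_on T)" by (rule measurable_restrict_mono[OF w])
  moreover have "AE t in lebesgue_on T. ereal (w t) \<le> ereal (2 powi (l + 1))"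
    using T by (intro AE_I2) (auto simp: dyadic_level_def)
  ultimately have "esssup (lebesgue_on T) (\<lambda>t. ereal (w t)) \<le> ereal (2 powi (l + 1))"
    by (intro esssup_I borel_measurable_ereal)
  then have "2 * esssup (lebesgue_on T) (\<lambda>t. ereal (w t)) \<le> 2 * ereal (2 powi (l + 1))"
    by (intro ereal_mult_left_mono) auto
  also have "\<dots> \<le> ereal (2 powi k)"
  proof -
    have "2 * (2::real) powi (l + 1) \<le> 2 powi k"
      using powi_2_Suc[of "l + 1"] powi_2_mono[of "l + 1 + 1" k] assms(4) by linarith
    then show ?thesis by simp
  qed
  also have "\<dots> \<le> essinf (lebesgue_on S) (\<lambda>t. ereal (w t))"
    unfolding essinf_def using S by (intro Sup_upper) (auto simp: dyadic_level_def intro!: AE_I2)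
  finally show ?thesis .
qed

lemma ex_decreasing_enumeration:
  fixes F :: "int set"
  assumes F: "finite F" and par: "\<And>k l. k \<in> F \<Longrightarrow> l \<in> F \<Longrightarrow> even (k - l)"
  shows "\<exists>e. bij_betw e {1..card F} F \<and> (\<forall>i\<in>{1..<card F}. e (i + 1) + 2 \<le> e i)"
proof -
  define ys where "ys = sorted_list_of_set F"
  define n where "n = card F"
  have ys: "set ys = F" "distinct ys" "sorted_wrt (<) ys" "length ys = n"
    using F by (auto simp: ys_def n_def)
  \<comment> \<open>Reversal of the increasing list with indices starting at 1, since
    decomposability lists the larger values of \<open>w\<close> first. Equal parity later widens the
    gaps to two.\<close>
  define e where "e i = ys ! (n - i)" for i
  have "bij_betw (\<lambda>i. n - i) {1..n} {..<n}"
    by (rule bij_betw_byWitness[where f' = "\<lambda>i. n - i"]) auto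
  moreover have "bij_betw ((!) ys) {..<n} F" using ys by (intro bij_betw_nth) auto
  ultimately have bij: "bij_betw e {1..n} F"
    unfolding e_def using bij_betw_trans[of "\<lambda>i. n - i"] by (fastforce simp: o_def)
  moreover have "e (i + 1) + 2 \<le> e i" if i: "i \<in> {1..<n}" for i
  proof -
    have "e (i + 1) < e i" unfolding e_def using i ys by (intro sorted_wrt_nth_less[OF ys(3)]) auto
    moreover have "even (e i - e (i + 1))"
      using i bij_betwE[OF bij] by (intro par) auto
    ultimately show ?thesis by presburger
  qed
  ultimately show ?thesis unfolding n_def by blast
qed

context lorentz_growth
begin

text \<open>A real-valued version, so that coefficients can be defined as quotients.\<close>

definition prim :: "real \<Rightarrow> real" where "prim s = enn2real (primitive s)"

lemma
  assumes "0 \<le> s" "s \<le> 1"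
  shows primitive_eq: "primitive s = ennreal (prim s)"
    and prim_nonneg: "0 \<le> prim s"
    and g_le_prim: "g s \<le> 2 * L * prim s"
    and prim_le: "prim s \<le> 2 / \<rho> * g s"
proof -
  show 1: "primitive s = ennreal (prim s)" and 2: "0 \<le> prim s"
    using primitive_finite[OF assms] by (auto simp: prim_def)
  have "ennreal (g s) \<le> ennreal (2 * L * prim s)"
    using primitive_ge[OF assms] 2 L_ge_1 unfolding 1 by (simp add: ennreal_mult)
  then show "g s \<le> 2 * L * prim s" using 2 L_ge_1 by (simp add: ennreal_le_iff)
  have "ennreal (prim s) \<le> ennreal (2 / \<rho> * g s)"
    using primitive_le[OF assms] nonneg[OF assms] \<rho>_pos unfolding 1 by (subst ennreal_mult) auto
  then show "prim s \<le> 2 / \<rho> * g s" using nonneg[OF assms] \<rho>_pos by (subst (asm) ennreal_le_iff) auto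
qed

lemma prim_pos: "0 < s \<Longrightarrow> s \<le> 1 \<Longrightarrow> 0 < prim s"
  using g_le_prim[of s] pos[of s] L_ge_1 by (smt (verit) mult_nonneg_nonpos)

lemma modular_le_of_norm_le:
  assumes "lorentz_norm p \<phi> u \<le> C * lorentz_norm p \<phi> v" "0 < C"
  shows "enn2real (lorentz_modular p \<phi> u) \<le> C powr p * enn2real (lorentz_modular p \<phi> v)"
proof -
  have eq: "enn2real (lorentz_modular p \<phi> z) = lorentz_norm p \<phi> z powr p" for z
    using p by (simp add: lorentz_norm_def powr_powr)
  have N: "0 \<le> lorentz_norm p \<phi> z" for z by (simp add: lorentz_norm_def)
  have "lorentz_norm p \<phi> u powr p \<le> (C * lorentz_norm p \<phi> v) powr p"
    using assms N p by (intro powr_mono2) auto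
  then show ?thesis unfolding eq using N assms by (simp add: powr_mult)
qed

text \<open>At height \<open>b\<close> the superlevel set of the sum is the union of the
  \<open>G i\<close> with \<open>b < c i\<close>. Whatever the coefficients, its measure is a
  lacunary sum, so \<open>lacunary\<close> gives constants independent of \<open>c\<close>.\<close>

lemma lorentz_modular_lacunary:
  fixes c :: "nat \<Rightarrow> real"
  assumes I: "finite I" and G: "\<And>i. i \<in> I \<Longrightarrow> G i \<in> sets unit_leb" "disjoint_family_on G I"
    and mG: "\<And>i. i \<in> I \<Longrightarrow> measure unit_leb (G i) = \<rho> ^ i * e" and e: "0 < e" "e \<le> 1"
    and c: "\<And>i. i \<in> I \<Longrightarrow> 0 < c i"
  shows "lorentz_modular p \<phi> (\<lambda>t. \<Sum>i\<in>I. c i * indicator (G i) t) \<le>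
      ennreal (L * modular_const) * (\<Sum>i\<in>I. lorentz_modular p \<phi> (\<lambda>t. c i * indicator (G i) t))"
    and "(\<Sum>i\<in>I. lorentz_modular p \<phi> (\<lambda>t. c i * indicator (G i) t)) \<le>
      ennreal (2 * modular_const) * lorentz_modular p \<phi> (\<lambda>t. \<Sum>i\<in>I. c i * indicator (G i) t)"
proof -
  define y where "y i = (\<lambda>t. c i * indicator (G i) t)" for i
  define Y where "Y = (\<lambda>t. \<Sum>i\<in>I. c i * indicator (G i) t)"
  have y: "y i \<in> borel_measurable unit_leb" if "i \<in> I" for i
    unfolding y_def using G(1)[OF that] by (intro borel_measurable_times borel_measurable_indicator) auto
  have Y: "Y \<in> borel_measurable unit_leb"
    unfolding Y_def using y unfolding y_def by (rule borel_measurable_sum)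
  have *: "g (distr_fun Y b) \<le> L * (\<Sum>i\<in>I. g (distr_fun (y i) b)) \<and>
      (\<Sum>i\<in>I. g (distr_fun (y i) b)) \<le> 2 * g (distr_fun Y b)" if b: "0 < b" for b
  proof -
    define J where "J = {i \<in> I. b < c i}"
    have J: "finite J" using I by (simp add: J_def)
    have "(\<Sum>i\<in>I. g (distr_fun (y i) b)) = (\<Sum>i\<in>I. if b < c i then g (\<rho> ^ i * e) else 0)"
      unfolding y_def using G c b by (intro sum.cong) (auto simp: distr_fun_indicator mG)
    then have 1: "(\<Sum>i\<in>I. g (distr_fun (y i) b)) = (\<Sum>i\<in>J. g (\<rho> ^ i * e))"
      using I by (simp add: sum.If_cases J_def Int_def)
    have U: "(\<Union>i\<in>J. G i) \<subseteq> {0..1}" using sets.sets_into_space[OF G(1)] by (auto simp: J_def)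
    have "{s \<in> {0..1}. \<bar>Y s\<bar> > b} = (\<Union>i\<in>J. G i)"
    proof (intro set_eqI)
      fix s
      have "b < \<bar>Y s\<bar> \<longleftrightarrow> (\<exists>i\<in>I. b < \<bar>c i * indicator (G i) s\<bar>)"
        unfolding Y_def using I b G(2)
        by (intro less_abs_sum_iff) (auto simp: disjoint_family_on_def indicator_def split: if_splits)
      also have "\<dots> \<longleftrightarrow> s \<in> (\<Union>i\<in>J. G i)"
        using b c by (force simp: J_def indicator_def abs_mult split: if_splits)
      finally show "s \<in> {s \<in> {0..1}. \<bar>Y s\<bar> > b} \<longleftrightarrow> s \<in> (\<Union>i\<in>J. G i)"
        using U by blast
    qed
    then have "distr_fun Y b = measure unit_leb (\<Union>i\<in>J. G i)" by (simp add: distr_fun_def)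
    also have "\<dots> = (\<Sum>i\<in>J. measure unit_leb (G i))"
      using J G by (intro unit_leb.finite_measure_finite_Union)
        (auto simp: J_def disjoint_family_on_def)
    also have "\<dots> = (\<Sum>i\<in>J. \<rho> ^ i * e)" by (intro sum.cong) (auto simp: J_def mG)
    finally have 2: "distr_fun Y b = (\<Sum>i\<in>J. \<rho> ^ i * e)" .
    then have "(\<Sum>i\<in>J. \<rho> ^ i * e) \<le> 1" using distr_fun_bounds(2)[of Y b] by simp
    then show ?thesis unfolding 1 2 using lacunary[OF J e] by simp
  qed
  show "lorentz_modular p \<phi> (\<lambda>t. \<Sum>i\<in>I. c i * indicator (G i) t) \<le>
      ennreal (L * modular_const) * (\<Sum>i\<in>I. lorentz_modular p \<phi> (\<lambda>t. c i * indicator (G i) t))"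
    using sum_lorentz_modular_le[of L "{()}" I "\<lambda>_. Y" y, OF _ _ I] L_ge_1 Y y *
    by (simp flip: Y_def y_def)
  show "(\<Sum>i\<in>I. lorentz_modular p \<phi> (\<lambda>t. c i * indicator (G i) t)) \<le>
      ennreal (2 * modular_const) * lorentz_modular p \<phi> (\<lambda>t. \<Sum>i\<in>I. c i * indicator (G i) t)"
    using sum_lorentz_modular_le[of 2 I "{()}" y "\<lambda>_. Y", OF _ I] Y y *
    by (simp flip: Y_def y_def)
qed

end

context lorentz_growth
begin

text \<open>Decomposability with its constant exposed, so that the later constants can be expressed
  through \<open>C\<close>.\<close>

definition w_decomposable_const :: "(real \<Rightarrow> real) \<Rightarrow> real \<Rightarrow> bool" where
  "w_decomposable_const w C \<longleftrightarrow> (\<forall>n\<ge>1. \<forall>x y :: nat \<Rightarrow> real \<Rightarrow> real.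
        (\<forall>i\<in>{1..n}. x i \<in> lorentz_space p \<phi> \<and> y i \<in> lorentz_space p \<phi> \<and>
           \<not> (AE t in unit_leb. x i t = 0) \<and> \<not> (AE t in unit_leb. y i t = 0) \<and>
           lorentz_norm p \<phi> (x i) = lorentz_norm p \<phi> (y i)) \<longrightarrow>
        (\<forall>i\<in>{1..<n}.
           essinf (lebesgue_on (supp (x i) \<union> supp (y i))) (\<lambda>t. ereal (w t))
             \<ge> 2 * esssup (lebesgue_on (supp (x (i + 1)) \<union> supp (y (i + 1)))) (\<lambda>t. ereal (w t))) \<longrightarrow>
        inverse C * lorentz_norm p \<phi> (\<lambda>t. \<Sum>i=1..n. x i t) \<le> lorentz_norm p \<phi> (\<lambda>t. \<Sum>i=1..n. y i t) \<and>
        lorentz_norm p \<phi> (\<lambda>t. \<Sum>i=1..n. y i t) \<le> C * lorentz_norm p \<phi> (\<lambda>t. \<Sum>i=1..n. x i t))"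

text \<open>One \<open>modular_const\<close> comes from \<open>lorentz_modular_lacunary\<close>, one
  from exchanging \<open>g\<close> with \<open>prim\<close> at both ends, and
  \<open>C powr p\<close> from decomposability; \<open>2 * L\<close> covers the remaining factors of
  the two directions.\<close>

definition parity_const :: "real \<Rightarrow> real" where
  "parity_const C = 2 * L * modular_const\<^sup>2 * C powr p"

text \<open>Indicators of sets of measure \<open>\<sigma> k\<close> are compared with multiples of indicators of sets of
  geometrically decreasing measure, which behave like disjoint vectors of \<open>\<ell>\<^sub>p\<close>.
  Levels of equal parity are needed because adjacent dyadic levels are not separated by a factor 2.\<close>

lemma w_decomposable_same_parity:
  fixes F :: "int set"
  assumes w: "w \<in> borel_measurable unit_leb" and C: "0 < C" "w_decomposable_const w C"
    and F: "finite F" and par: "\<And>k l. k \<in> F \<Longrightarrow> l \<in> F \<Longrightarrow> even (k - l)"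
    and \<sigma>: "\<And>k. k \<in> F \<Longrightarrow> 0 < \<sigma> k" "\<And>k. k \<in> F \<Longrightarrow> \<sigma> k \<le> measure unit_leb (dyadic_level w k)"
  shows "g (\<Sum>k\<in>F. \<sigma> k) \<le> parity_const C * (\<Sum>k\<in>F. g (\<sigma> k))"
    and "(\<Sum>k\<in>F. g (\<sigma> k)) \<le> parity_const C * g (\<Sum>k\<in>F. \<sigma> k)"
proof -
  let ?m = "measure unit_leb"
  have "g (\<Sum>k\<in>F. \<sigma> k) \<le> parity_const C * (\<Sum>k\<in>F. g (\<sigma> k)) \<and>
      (\<Sum>k\<in>F. g (\<sigma> k)) \<le> parity_const C * g (\<Sum>k\<in>F. \<sigma> k)"
  proof (cases "F = {}")
    case False
    define n where "n = card F"
    have n: "1 \<le> n" using False F by (simp add: n_def Suc_le_eq card_gt_0_iff)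
    obtain e where e: "bij_betw e {1..n} F" "\<And>i. i \<in> {1..<n} \<Longrightarrow> e (i + 1) + 2 \<le> e i"
      using ex_decreasing_enumeration[OF F par] unfolding n_def by blast
    have eF: "e i \<in> F" if "i \<in> {1..n}" for i using bij_betwE[OF e(1)] that by auto
    define a where "a k = ?m (dyadic_level w k)" for k
    \<comment> \<open>Small enough that a set of measure \<open>\<rho> ^ i * \<epsilon>\<close> fits
      into every level under consideration.\<close>
    define \<epsilon> where "\<epsilon> = Min (a ` F)"
    have a0: "0 < a k" if "k \<in> F" for k using \<sigma>[OF that] by (simp add: a_def)
    have \<epsilon>: "0 < \<epsilon>" "\<And>k. k \<in> F \<Longrightarrow> \<epsilon> \<le> a k" using F False a0 by (auto simp: \<epsilon>_def)
    have \<epsilon>1: "\<epsilon> \<le> 1" using \<epsilon>(2) False measure_unit_leb_le_1 unfolding a_def by (meson ex_in_conv order_trans)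
    have \<epsilon>i: "0 < \<rho> ^ i * \<epsilon>" "\<rho> ^ i * \<epsilon> \<le> \<epsilon>" for i
      using \<epsilon>(1) \<rho>_power[of i] by (auto intro: mult_left_le_one_le)
    have "\<exists>E. E \<in> sets unit_leb \<and> E \<subseteq> dyadic_level w (e i) \<and> ?m E = \<sigma> (e i)" if "i \<in> {1..n}" for i
      using ex_subset_measure_eq[OF dyadic_level_sets[OF w], of "\<sigma> (e i)" "e i"] \<sigma>[OF eF[OF that]] by auto
    then obtain E where E: "\<And>i. i \<in> {1..n} \<Longrightarrow> E i \<in> sets unit_leb"
        "\<And>i. i \<in> {1..n} \<Longrightarrow> E i \<subseteq> dyadic_level w (e i)" "\<And>i. i \<in> {1..n} \<Longrightarrow> ?m (E i) = \<sigma> (e i)"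
      by metis
    have "\<exists>G. G \<in> sets unit_leb \<and> G \<subseteq> dyadic_level w (e i) \<and> ?m G = \<rho> ^ i * \<epsilon>" if "i \<in> {1..n}" for i
      using ex_subset_measure_eq[OF dyadic_level_sets[OF w], of "\<rho> ^ i * \<epsilon>" "e i"] \<epsilon>i[of i] \<epsilon>(2)[OF eF[OF that]]
      by (fastforce simp: a_def)
    then obtain G where G: "\<And>i. i \<in> {1..n} \<Longrightarrow> G i \<in> sets unit_leb"
        "\<And>i. i \<in> {1..n} \<Longrightarrow> G i \<subseteq> dyadic_level w (e i)" "\<And>i. i \<in> {1..n} \<Longrightarrow> ?m (G i) = \<rho> ^ i * \<epsilon>"
      by metis
    have disj: "disjoint_family_on H {1..n}"
      if H: "\<And>i. i \<in> {1..n} \<Longrightarrow> H i \<subseteq> dyadic_level w (e i)" for H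
      unfolding disjoint_family_on_def
    proof (intro ballI impI)
      fix i j assume ij: "i \<in> {1..n}" "j \<in> {1..n}" "i \<noteq> j"
      then have "e i \<noteq> e j" using inj_on_eq_iff[OF bij_betw_imp_inj_on[OF e(1)]] by simp
      then have "dyadic_level w (e i) \<inter> dyadic_level w (e j) = {}"
        by (intro disjoint_family_onD[OF disjoint_dyadic_level]) auto
      then show "H i \<inter> H j = {}" using H[OF ij(1)] H[OF ij(2)] by blast
    qed
    have \<sigma>1: "0 < \<sigma> (e i)" "\<sigma> (e i) \<le> 1" if "i \<in> {1..n}" for i
      using \<sigma>[OF eF[OF that]] measure_unit_leb_le_1[of "dyadic_level w (e i)"] by linarith+
    have \<epsilon>p: "0 < prim (\<rho> ^ i * \<epsilon>)" for i using \<epsilon>i[of i] \<epsilon>1 by (intro prim_pos) auto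
    have \<sigma>p: "0 < prim (\<sigma> (e i))" if "i \<in> {1..n}" for i using \<sigma>1[OF that] by (intro prim_pos) auto
    \<comment> \<open>Solves \<open>c i powr p * prim (\<rho> ^ i * \<epsilon>) = prim (\<sigma> (e
      i))\<close>, the equality of the modulars of \<open>y i\<close> and
      \<open>x i\<close>.\<close>
    define c where "c i = (prim (\<sigma> (e i)) / prim (\<rho> ^ i * \<epsilon>)) powr (1 / p)" for i
    have c: "0 < c i" if "i \<in> {1..n}" for i using \<epsilon>p[of i] \<sigma>p[OF that] by (simp add: c_def)
    define x where "x i = (\<lambda>t. 1 * indicator (E i) t :: real)" for i
    define y where "y i = (\<lambda>t. c i * indicator (G i) t)" for i
    have modx: "lorentz_modular p \<phi> (x i) = ennreal (prim (\<sigma> (e i)))" if "i \<in> {1..n}" for i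
      unfolding x_def using lorentz_modular_indicator[OF E(1)[OF that], of 1] \<sigma>1[OF that]
      by (simp add: E(3)[OF that] primitive_eq)
    have mody: "lorentz_modular p \<phi> (y i) = ennreal (prim (\<sigma> (e i)))" if "i \<in> {1..n}" for i
    proof -
      have "lorentz_modular p \<phi> (y i) = ennreal (c i powr p) * ennreal (prim (\<rho> ^ i * \<epsilon>))"
        unfolding y_def using lorentz_modular_indicator[OF G(1)[OF that] c[OF that]] \<epsilon>i[of i] \<epsilon>1
        by (simp add: G(3)[OF that] primitive_eq)
      also have "\<dots> = ennreal (c i powr p * prim (\<rho> ^ i * \<epsilon>))" using \<epsilon>p[of i] by (simp add: ennreal_mult)
      also have "c i powr p * prim (\<rho> ^ i * \<epsilon>) = prim (\<sigma> (e i))"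
        using \<epsilon>p[of i] \<sigma>p[OF that] p by (simp add: c_def powr_powr)
      finally show ?thesis .
    qed
    have mx: "x i \<in> borel_measurable unit_leb" if "i \<in> {1..n}" for i
      unfolding x_def using E(1)[OF that] by (intro borel_measurable_times borel_measurable_indicator) auto
    have my: "y i \<in> borel_measurable unit_leb" if "i \<in> {1..n}" for i
      unfolding y_def using G(1)[OF that] by (intro borel_measurable_times borel_measurable_indicator) auto
    define Y where "Y = (\<lambda>t. \<Sum>i=1..n. y i t)"
    define X where "X = (\<lambda>t. \<Sum>i=1..n. x i t)"
    have "inverse C * lorentz_norm p \<phi> X \<le> lorentz_norm p \<phi> Y \<and> lorentz_norm p \<phi> Y \<le> C * lorentz_norm p \<phi> X"
      unfolding X_def Y_def
    proof (rule C(2)[unfolded w_decomposable_const_def, rule_format, OF n])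
      fix i assume i: "i \<in> {1..n}"
      have "lorentz_norm p \<phi> (x i) = lorentz_norm p \<phi> (y i)"
        by (simp add: lorentz_norm_def modx[OF i] mody[OF i])
      moreover have "\<not> (AE t in unit_leb. x i t = 0)"
        unfolding x_def using E(1)[OF i] E(3)[OF i] \<sigma>1[OF i] by (intro not_AE_indicator_eq_0) auto
      moreover have "\<not> (AE t in unit_leb. y i t = 0)"
        unfolding y_def using G(1)[OF i] G(3)[OF i] \<epsilon>i[of i] c[OF i] by (intro not_AE_indicator_eq_0) auto
      ultimately show "x i \<in> lorentz_space p \<phi> \<and> y i \<in> lorentz_space p \<phi> \<and>
          \<not> (AE t in unit_leb. x i t = 0) \<and> \<not> (AE t in unit_leb. y i t = 0) \<and>
          lorentz_norm p \<phi> (x i) = lorentz_norm p \<phi> (y i)"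
        using mx[OF i] my[OF i] by (simp add: lorentz_space_def modx[OF i] mody[OF i])
    next
      fix i assume i: "i \<in> {1..<n}"
      have "supp (x j) \<union> supp (y j) \<subseteq> dyadic_level w (e j)" if "j \<in> {1..n}" for j
        using E(2)[OF that] G(2)[OF that]
        by (auto simp: supp_def x_def y_def indicator_def split: if_splits)
      then show "2 * esssup (lebesgue_on (supp (x (i + 1)) \<union> supp (y (i + 1)))) (\<lambda>t. ereal (w t))
          \<le> essinf (lebesgue_on (supp (x i) \<union> supp (y i))) (\<lambda>t. ereal (w t))"
        using i e(2)[OF i] by (intro separated_dyadic_levels[OF w]) auto
    qed
    then have XY: "lorentz_norm p \<phi> X \<le> C * lorentz_norm p \<phi> Y" "lorentz_norm p \<phi> Y \<le> C * lorentz_norm p \<phi> X"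
      using C(1) by (auto simp: field_simps)
    define s where "s = (\<Sum>k\<in>F. \<sigma> k)"
    have sE: "s = ?m (\<Union>i\<in>{1..n}. E i)"
    proof -
      have "?m (\<Union>i\<in>{1..n}. E i) = (\<Sum>i=1..n. ?m (E i))"
        using E(1) disj[OF E(2)] by (intro unit_leb.finite_measure_finite_Union) auto
      also have "\<dots> = (\<Sum>i=1..n. \<sigma> (e i))" using E(3) by simp
      also have "\<dots> = s" unfolding s_def by (rule sum.reindex_bij_betw[OF e(1)])
      finally show ?thesis ..
    qed
    have s1: "0 \<le> s" "s \<le> 1" unfolding sE by (simp_all add: measure_unit_leb_le_1)
    have XE: "X = (\<lambda>t. 1 * indicator (\<Union>i\<in>{1..n}. E i) t)"
      unfolding X_def x_def using disj[OF E(2)] by (simp add: indicator_UN_disjoint)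
    have "(\<Union>i\<in>{1..n}. E i) \<in> sets unit_leb" using E(1) by (intro sets.finite_UN) auto
    then have "lorentz_modular p \<phi> X = ennreal (1 powr p) * primitive s"
      unfolding XE sE by (intro lorentz_modular_indicator) auto
    then have modX: "lorentz_modular p \<phi> X = ennreal (prim s)" by (simp add: primitive_eq[OF s1])
    define Q where "Q = enn2real (lorentz_modular p \<phi> Y)"
    define v where "v = (\<Sum>k\<in>F. prim (\<sigma> k))"
    have v: "v = (\<Sum>i=1..n. prim (\<sigma> (e i)))"
      unfolding v_def by (rule sum.reindex_bij_betw[OF e(1), symmetric])
    have v0: "0 \<le> v" unfolding v using \<sigma>p by (intro sum_nonneg) (auto intro: less_imp_le)
    have "(\<Sum>i=1..n. lorentz_modular p \<phi> (y i)) = (\<Sum>i=1..n. ennreal (prim (\<sigma> (e i))))"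
      by (rule sum.cong[OF refl mody])
    also have "\<dots> = ennreal v" unfolding v by (rule sum_ennreal) (rule less_imp_le[OF \<sigma>p])
    finally have sv: "(\<Sum>i=1..n. lorentz_modular p \<phi> (y i)) = ennreal v" .
    have disjG: "disjoint_family_on G {1..n}" by (rule disj, rule G(2))
    have lac1: "lorentz_modular p \<phi> Y \<le> ennreal (L * modular_const) * ennreal v"
      unfolding sv[symmetric] Y_def y_def
      by (rule lorentz_modular_lacunary[OF finite_atLeastAtMost _ disjG _ \<epsilon>(1) \<epsilon>1]; fact G c)
    have lac2: "ennreal v \<le> ennreal (2 * modular_const) * lorentz_modular p \<phi> Y"
      unfolding sv[symmetric] Y_def y_def
      by (rule lorentz_modular_lacunary[OF finite_atLeastAtMost _ disjG _ \<epsilon>(1) \<epsilon>1]; fact G c)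
    have "lorentz_modular p \<phi> Y < top" by (rule le_less_trans[OF lac1]) (simp add: ennreal_mult_less_top)
    then have QY: "lorentz_modular p \<phi> Y = ennreal Q" "0 \<le> Q" by (auto simp: Q_def)
    have MC: "0 < modular_const" by (rule modular_const_pos)
    have Q1: "Q \<le> L * modular_const * v"
      using lac1 MC L_ge_1 v0 unfolding QY by (simp add: ennreal_mult[symmetric])
    have Q2: "v \<le> 2 * modular_const * Q"
      using lac2 MC QY(2) unfolding QY by (simp add: ennreal_mult[symmetric])
    have N1: "prim s \<le> C powr p * Q" and N2: "Q \<le> C powr p * prim s"
      using modular_le_of_norm_le[OF XY(1) C(1)] modular_le_of_norm_le[OF XY(2) C(1)]
        prim_nonneg[OF s1] by (simp_all add: modX Q_def[symmetric])
    have \<sigma>F: "0 \<le> \<sigma> k" "\<sigma> k \<le> 1" if "k \<in> F" for k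
      using \<sigma>[OF that] measure_unit_leb_le_1[of "dyadic_level w k"] by linarith+
    define u where "u = (\<Sum>k\<in>F. g (\<sigma> k))"
    have uv: "v \<le> 2 / \<rho> * u" "u \<le> 2 * L * v"
      unfolding u_def v_def sum_distrib_left by (intro sum_mono prim_le g_le_prim \<sigma>F; assumption)+
    have u0: "0 \<le> u" unfolding u_def using \<sigma>F by (intro sum_nonneg nonneg) auto
    have Cp: "0 < C powr p" using C by simp
    \<comment> \<open>The chain runs from \<open>g s\<close> over the modulars of \<open>X\<close>
      and \<open>Y\<close> and the sum \<open>v\<close> to \<open>u\<close>; the second direction
      traverses it backwards.\<close>
    have "g s \<le> 2 * L * prim s" by (rule g_le_prim[OF s1])
    also have "\<dots> \<le> 2 * L * (C powr p * Q)" using N1 L_ge_1 by (intro mult_left_mono) auto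
    also have "\<dots> \<le> 2 * L * (C powr p * (L * modular_const * v))"
      using Q1 L_ge_1 Cp by (intro mult_left_mono) auto
    also have "\<dots> \<le> 2 * L * (C powr p * (L * modular_const * (2 / \<rho> * u)))"
      using uv(1) L_ge_1 Cp MC by (intro mult_left_mono) auto
    also have "\<dots> = L * modular_const\<^sup>2 * C powr p * u"
      using \<rho>_pos by (simp add: modular_const_def field_simps power2_eq_square)
    also have "\<dots> \<le> parity_const C * u"
      unfolding parity_const_def using L_ge_1 Cp u0 by (intro mult_right_mono) auto
    finally have 1: "g s \<le> parity_const C * u" .
    have "u \<le> 2 * L * v" by (rule uv)
    also have "\<dots> \<le> 2 * L * (2 * modular_const * Q)" using Q2 L_ge_1 by (intro mult_left_mono) auto
    also have "\<dots> \<le> 2 * L * (2 * modular_const * (C powr p * prim s))"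
      using N2 L_ge_1 MC by (intro mult_left_mono) auto
    also have "\<dots> \<le> 2 * L * (2 * modular_const * (C powr p * (2 / \<rho> * g s)))"
      using prim_le[OF s1] L_ge_1 MC Cp by (intro mult_left_mono) auto
    also have "\<dots> = 2 * modular_const\<^sup>2 * C powr p * g s"
      using \<rho>_pos by (simp add: modular_const_def field_simps power2_eq_square)
    also have "\<dots> \<le> 2 * modular_const\<^sup>2 * C powr p * g s * L"
      using L_ge_1 Cp nonneg[OF s1] mult_left_mono[of 1 L "2 * modular_const\<^sup>2 * C powr p * g s"] by simp
    finally have "u \<le> parity_const C * g s" by (simp add: parity_const_def mult_ac)
    then show ?thesis using 1 by (simp add: s_def u_def)
  qed simp
  then show "g (\<Sum>k\<in>F. \<sigma> k) \<le> parity_const C * (\<Sum>k\<in>F. g (\<sigma> k))"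
    and "(\<Sum>k\<in>F. g (\<sigma> k)) \<le> parity_const C * g (\<Sum>k\<in>F. \<sigma> k)" by auto
qed

text \<open>Split into even and odd levels. The larger of the two partial sums is at least half of
  the total, so doubling recombines them.\<close>

lemma w_decomposable_finite:
  fixes F :: "int set"
  assumes w: "w \<in> borel_measurable unit_leb" and C: "0 < C" "w_decomposable_const w C"
    and F: "finite F" and \<sigma>: "\<And>k. k \<in> F \<Longrightarrow> 0 < \<sigma> k"
      "\<And>k. k \<in> F \<Longrightarrow> \<sigma> k \<le> measure unit_leb (dyadic_level w k)"
  shows "g (\<Sum>k\<in>F. \<sigma> k) \<le> 2 * L * parity_const C * (\<Sum>k\<in>F. g (\<sigma> k))"
    and "(\<Sum>k\<in>F. g (\<sigma> k)) \<le> 2 * L * parity_const C * g (\<Sum>k\<in>F. \<sigma> k)"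
proof -
  define K where "K = parity_const C"
  have K: "0 < K" using L_ge_1 modular_const_pos C(1) by (simp add: K_def parity_const_def)
  define A where "A = {k \<in> F. even k}"
  define B where "B = {k \<in> F. odd k}"
  have AB: "finite A" "finite B" "A \<inter> B = {}" "F = A \<union> B" using F by (auto simp: A_def B_def)
  have split: "(\<Sum>k\<in>F. f k) = (\<Sum>k\<in>A. f k) + (\<Sum>k\<in>B. f k)" for f :: "int \<Rightarrow> real"
    unfolding AB(4) using AB by (intro sum.union_disjoint)
  define sA sB uA uB where "sA = (\<Sum>k\<in>A. \<sigma> k)" and "sB = (\<Sum>k\<in>B. \<sigma> k)"
    and "uA = (\<Sum>k\<in>A. g (\<sigma> k))" and "uB = (\<Sum>k\<in>B. g (\<sigma> k))"
  have "g sA \<le> K * uA" "uA \<le> K * g sA"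
    unfolding sA_def uA_def K_def
    by (rule w_decomposable_same_parity[OF w C AB(1)]; use \<sigma> in \<open>auto simp: A_def\<close>)+
  moreover have "g sB \<le> K * uB" "uB \<le> K * g sB"
    unfolding sB_def uB_def K_def
    by (rule w_decomposable_same_parity[OF w C AB(2)]; use \<sigma> in \<open>auto simp: B_def\<close>)+
  ultimately have P: "g sA \<le> K * uA" "uA \<le> K * g sA" "g sB \<le> K * uB" "uB \<le> K * g sB" by auto
  have s0: "0 \<le> sA" "0 \<le> sB"
    unfolding sA_def sB_def using \<sigma>(1) by (auto simp: A_def B_def intro!: sum_nonneg intro: less_imp_le)
  have "sA + sB \<le> (\<Sum>k\<in>F. measure unit_leb (dyadic_level w k))"
    unfolding sA_def sB_def split[symmetric] by (intro sum_mono \<sigma>)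
  also have "\<dots> \<le> 1" by (rule sum_dyadic_level_le_1[OF w F])
  finally have s1: "sA + sB \<le> 1" .
  have gn: "0 \<le> g sA" "0 \<le> g sB" using s0 s1 by (auto intro!: nonneg)
  then have u0: "0 \<le> K * uA" "0 \<le> K * uB" using P by auto
  have "g (sA + sB) \<le> L * g (max sA sB)" using s0 s1 by (intro le_L_mult) auto
  also have "\<dots> \<le> L * (K * uA + K * uB)"
    using gn P u0 L_ge_1 by (intro mult_left_mono) (auto simp: max_def)
  also have "\<dots> \<le> 2 * (L * (K * uA + K * uB))" using u0 L_ge_1 by simp
  finally show "g (\<Sum>k\<in>F. \<sigma> k) \<le> 2 * L * parity_const C * (\<Sum>k\<in>F. g (\<sigma> k))"
    unfolding split sA_def[symmetric] sB_def[symmetric] uA_def[symmetric] uB_def[symmetric] K_def[symmetric]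
    by (simp add: algebra_simps)
  have m: "g sA \<le> g (sA + sB)" "g sB \<le> g (sA + sB)" using s0 s1 by (auto intro!: mono)
  have "uA + uB \<le> K * g (sA + sB) + K * g (sA + sB)"
    using P(2,4) m K by (meson add_mono less_imp_le mult_left_mono order_trans)
  also have "\<dots> = 2 * K * g (sA + sB) * 1" by simp
  also have "\<dots> \<le> 2 * K * g (sA + sB) * L"
    using L_ge_1 K gn(1) m(1) by (intro mult_left_mono) auto
  finally show "(\<Sum>k\<in>F. g (\<sigma> k)) \<le> 2 * L * parity_const C * g (\<Sum>k\<in>F. \<sigma> k)"
    unfolding split sA_def[symmetric] sB_def[symmetric] uA_def[symmetric] uB_def[symmetric] K_def[symmetric]
    by (simp add: mult_ac)
qed

lemma seq_decomposable_if_w_decomposable: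
  assumes w: "w \<in> borel_measurable unit_leb"
    and dec: "w_decomposable w (lorentz_space p \<phi>) (lorentz_norm p \<phi>)"
  shows "\<exists>K>0. seq_decomposable (\<lambda>k. measure unit_leb (dyadic_level w k)) K"
proof -
  obtain C where C: "0 < C" "w_decomposable_const w C"
    using dec unfolding w_decomposable_def w_decomposable_const_def by blast
  define a where "a k = measure unit_leb (dyadic_level w k)" for k
  define D where "D = 2 * L * parity_const C"
  have D: "0 < D" using L_ge_1 modular_const_pos C(1) by (simp add: D_def parity_const_def)
  \<comment> \<open>One \<open>L\<close> pays for replacing \<open>\<tau> j\<close> by
    \<open>\<tau> j / 2\<close>, the other for replacing the full sum by a partial sum exceeding
    half of it.\<close>
  define K where "K = L\<^sup>2 * D"
  have K: "0 < K" using D L_ge_1 by (simp add: K_def)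
  have sum_a: "(\<Sum>k\<in>F. a k) \<le> 1" if "finite F" for F
    unfolding a_def by (rule sum_dyadic_level_le_1[OF w that])
  have "summable (\<lambda>r. g (\<tau> r)) \<and> g (suminf \<tau>) \<le> K * (\<Sum>r. g (\<tau> r)) \<and> (\<Sum>r. g (\<tau> r)) \<le> K * g (suminf \<tau>)"
    if \<tau>: "\<forall>r. 0 < \<tau> r \<and> \<tau> r \<le> family_rearr a r" for \<tau>
  proof -
    have \<tau>0: "0 < \<tau> r" and \<tau>1: "\<tau> r \<le> family_rearr a r" for r using \<tau> by auto
    have sm: "summable \<tau>" and t1: "suminf \<tau> \<le> 1"
      using summable_le_family_rearr[of a \<tau>, OF sum_a \<tau>0 \<tau>1] suminf_le_family_rearr[of a \<tau>, OF sum_a \<tau>0 \<tau>1]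
      by auto
    have part: "sum \<tau> A \<le> suminf \<tau>" if "finite A" for A
      by (rule sum_le_suminf[OF sm that]) (use \<tau>0 in \<open>auto intro: less_imp_le\<close>)
    have \<tau>le: "\<tau> j \<le> 1" for j using part[of "{j}"] t1 by simp
    have t0: "0 \<le> suminf \<tau>" using part[of "{}"] by simp
    \<comment> \<open>Halving gives strict inequality with the rearrangement, hence distinct levels of measure above \<open>\<tau> j / 2\<close>.\<close>
    have fin: "g (\<Sum>j<N. \<tau> j / 2) \<le> D * (\<Sum>j<N. g (\<tau> j / 2)) \<and>
        (\<Sum>j<N. g (\<tau> j / 2)) \<le> D * g (\<Sum>j<N. \<tau> j / 2)" for N
    proof -
      have "0 \<le> \<tau> j / 2 \<and> \<tau> j / 2 < family_rearr a j" for j using \<tau>0[of j] \<tau>1[of j] by simp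
      then obtain k where k: "inj_on k {..<N}" "\<forall>j<N. \<tau> j / 2 < a (k j)"
        using ex_inj_less_of_less_family_rearr[of N "\<lambda>j. \<tau> j / 2" a] by auto
      \<comment> \<open>Relabels the halved terms by the levels chosen for them, as the finite
        estimate expects a family indexed by levels.\<close>
      define q where "q = the_inv_into {..<N} k"
      have q: "q (k j) = j" if "j < N" for j
        unfolding q_def using k(1) that by (intro the_inv_into_f_f) auto
      have "g (\<Sum>l\<in>k ` {..<N}. \<tau> (q l) / 2) \<le> D * (\<Sum>l\<in>k ` {..<N}. g (\<tau> (q l) / 2))"
        "(\<Sum>l\<in>k ` {..<N}. g (\<tau> (q l) / 2)) \<le> D * g (\<Sum>l\<in>k ` {..<N}. \<tau> (q l) / 2)"
        unfolding D_def
        by (rule w_decomposable_finite[OF w C]; use \<tau>0 k(2) q in \<open>auto simp: a_def intro: less_imp_le\<close>)+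
      then show ?thesis using q by (simp add: sum.reindex[OF k(1)])
    qed
    have half: "g (\<tau> j) \<le> L * g (\<tau> j / 2)" "g (\<tau> j / 2) \<le> g (\<tau> j)" "0 \<le> g (\<tau> j)" for j
      using \<tau>0[of j] \<tau>le[of j] by (auto intro!: doubling mono nonneg)
    have hs: "(\<Sum>j<N. \<tau> j / 2) \<le> suminf \<tau>" "0 \<le> (\<Sum>j<N. \<tau> j / 2)" for N
      using part[of "{..<N}"] t0 \<tau>0 by (auto simp: sum_divide_distrib[symmetric] intro!: sum_nonneg intro: less_imp_le)
    have LK: "L * D \<le> K" using L_ge_1 D by (simp add: K_def power2_eq_square)
    have up: "(\<Sum>j<N. g (\<tau> j)) \<le> K * g (suminf \<tau>)" for N
    proof -
      have "(\<Sum>j<N. g (\<tau> j)) \<le> L * (\<Sum>j<N. g (\<tau> j / 2))"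
        unfolding sum_distrib_left by (intro sum_mono half)
      also have "\<dots> \<le> L * (D * g (\<Sum>j<N. \<tau> j / 2))" using fin L_ge_1 by (intro mult_left_mono) auto
      also have "\<dots> \<le> L * (D * g (suminf \<tau>))"
        using hs t1 D L_ge_1 by (intro mult_left_mono mono) auto
      also have "\<dots> \<le> K * g (suminf \<tau>)"
        using LK nonneg[OF t0 t1] by (simp add: mult.assoc[symmetric] mult_right_mono)
      finally show ?thesis .
    qed
    have sg: "summable (\<lambda>r. g (\<tau> r))" using up half(3) by (intro summableI_nonneg_bounded) auto
    have "(\<lambda>N. \<Sum>j<N. \<tau> j) \<longlonglongrightarrow> suminf \<tau>" by (rule summable_LIMSEQ[OF sm])
    moreover have "suminf \<tau> / 2 < suminf \<tau>" using suminf_pos[OF sm \<tau>0] by simp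
    ultimately have "eventually (\<lambda>N. suminf \<tau> / 2 < (\<Sum>j<N. \<tau> j)) sequentially" by (rule order_tendstoD)
    then obtain N where N: "suminf \<tau> / 2 < (\<Sum>j<N. \<tau> j)"
      using eventually_happens'[OF sequentially_bot] by blast
    have N1: "(\<Sum>j<N. \<tau> j) \<le> 1" "0 \<le> (\<Sum>j<N. \<tau> j)"
      using part[of "{..<N}"] t1 t0 N by auto
    have "g (suminf \<tau>) \<le> L * g (\<Sum>j<N. \<tau> j)" using t0 t1 N N1 by (intro le_L_mult) auto
    also have "\<dots> \<le> L * (L * g (\<Sum>j<N. \<tau> j / 2))"
      using N1 L_ge_1 unfolding sum_divide_distrib[symmetric] by (intro mult_left_mono doubling) auto
    also have "\<dots> \<le> L * (L * (D * (\<Sum>j<N. g (\<tau> j / 2))))" using fin L_ge_1 by (intro mult_left_mono) auto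
    also have "\<dots> \<le> L * (L * (D * (\<Sum>j<N. g (\<tau> j))))"
      using L_ge_1 D half by (intro mult_left_mono sum_mono) auto
    also have "\<dots> \<le> L * (L * (D * (\<Sum>r. g (\<tau> r))))"
      using L_ge_1 D half by (intro mult_left_mono sum_le_suminf[OF sg]) auto
    finally have "g (suminf \<tau>) \<le> K * (\<Sum>r. g (\<tau> r))" by (simp add: K_def power2_eq_square mult.assoc)
    moreover have "(\<Sum>r. g (\<tau> r)) \<le> K * g (suminf \<tau>)" using up sg by (intro suminf_le_const) auto
    ultimately show ?thesis using sg by simp
  qed
  then show ?thesis using K unfolding seq_decomposable_def a_def by blast
qed

end

section \<open>Dilation indices and the theorem\<close>

text \<open>On (0,1) monotonicity confines the dilation function to [0,1]. A positive index forbids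
  that it takes only the values 0 and 1, and any value below 1 is a contraction factor.\<close>

lemma
  assumes mono: "mono_on {0..1} \<phi>" and "\<phi> 0 = 0" and ind: "0 < lower_dilation_index \<phi>"
  shows ex_dilation_contraction: "\<exists>t q. 0 < t \<and> t < 1 \<and> q < 1 \<and> (\<forall>s\<in>{0<..1}. \<phi> (s * t) \<le> q * \<phi> s)"
    and ex_nonzero_of_dilation_index: "\<exists>s\<in>{0<..1}. \<phi> s \<noteq> 0"
proof -
  have nonneg: "0 \<le> \<phi> s" if "s \<in> {0..1}" for s
    using mono_onD[OF mono, of 0 s] that assms(2) by simp
  define A where "A t = {\<phi> (s * t) / \<phi> s | s. s \<in> {0<..1} \<and> s * t \<in> {0<..1}}" for t
  have dil: "dilation_fun \<phi> t = Sup (A t)" for t by (simp add: dilation_fun_def A_def)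
  have A01: "0 \<le> r \<and> r \<le> 1" if t: "0 < t" "t < 1" and r: "r \<in> A t" for t r
  proof -
    obtain s where s: "s \<in> {0<..1}" "s * t \<in> {0<..1}" "r = \<phi> (s * t) / \<phi> s" using r by (auto simp: A_def)
    have "\<phi> (s * t) \<le> \<phi> s" using s t by (intro mono_onD[OF mono]) auto
    then show ?thesis using nonneg[of s] nonneg[of "s * t"] s by (auto simp: divide_le_eq_1)
  qed
  have ne: "\<phi> t / \<phi> 1 \<in> A t" if "0 < t" "t < 1" for t
    unfolding A_def using that by (intro CollectI exI[of _ 1]) auto
  have bdd: "bdd_above (A t)" if "0 < t" "t < 1" for t using A01[OF that] by (auto intro: bdd_aboveI[of _ 1])
  have dil01: "0 \<le> dilation_fun \<phi> t" "dilation_fun \<phi> t \<le> 1" if t: "0 < t" "t < 1" for t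
    unfolding dil using A01[OF t] ne[OF t] bdd[OF t]
    by (auto intro!: cSup_least intro: cSup_upper2)
  \<comment> \<open>Otherwise the quotient defining the index vanishes near 0, also where \<open>ln 0 = 0\<close> is used.\<close>
  have "\<exists>t. 0 < t \<and> t < 1 \<and> dilation_fun \<phi> t \<noteq> 0 \<and> dilation_fun \<phi> t \<noteq> 1"
  proof (rule ccontr)
    assume "\<not> ?thesis"
    then have "ln (dilation_fun \<phi> t) / ln t = 0" if "0 < t" "t < 1" for t using that by force
    then have "eventually (\<lambda>t. ln (dilation_fun \<phi> t) / ln t = 0) (at_right 0)"
      unfolding eventually_at_right_field by (intro exI[of _ 1]) auto
    then have "((\<lambda>t. ln (dilation_fun \<phi> t) / ln t) \<longlongrightarrow> 0) (at_right 0)" by (rule tendsto_eventually)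
    then have "lower_dilation_index \<phi> = 0"
      unfolding lower_dilation_index_def by (intro tendsto_Lim) auto
    then show False using ind by simp
  qed
  then obtain t where t: "0 < t" "t < 1" and dt: "dilation_fun \<phi> t \<noteq> 0" "dilation_fun \<phi> t \<noteq> 1" by auto
  show "\<exists>s\<in>{0<..1}. \<phi> s \<noteq> 0"
  proof (rule ccontr)
    assume "\<not> ?thesis"
    \<comment> \<open>If \<open>\<phi>\<close> vanished, all quotients would be 0 / 0 = 0, making
      the dilation function 0 at \<open>t\<close>.\<close>
    then have "A t \<subseteq> {0}" by (auto simp: A_def)
    then have "A t = {0}" using ne[OF t] by (auto dest: subset_singletonD)
    then show False using dt(1) by (simp add: dil)
  qed
  have "\<phi> (s * t) \<le> dilation_fun \<phi> t * \<phi> s" if s: "s \<in> {0<..1}" for s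
  proof (cases "\<phi> s = 0")
    case True
    have "\<phi> (s * t) \<le> \<phi> s" using s t by (intro mono_onD[OF mono]) (auto simp: mult_le_one)
    then show ?thesis using True by simp
  next
    case False
    have "s * t \<in> {0<..1}" using s t by (auto simp: mult_le_one)
    then have "\<phi> (s * t) / \<phi> s \<in> A t" unfolding A_def using s by (intro CollectI exI[of _ s]) auto
    then have "\<phi> (s * t) / \<phi> s \<le> dilation_fun \<phi> t" unfolding dil by (intro cSup_upper bdd t)
    then show ?thesis using False nonneg[of s] s by (simp add: divide_le_eq)
  qed
  then show "\<exists>t q. 0 < t \<and> t < 1 \<and> q < 1 \<and> (\<forall>s\<in>{0<..1}. \<phi> (s * t) \<le> q * \<phi> s)"
    using t dil01(2)[OF t] dt(2) by (intro exI[of _ t] exI[of _ "dilation_fun \<phi> t"]) auto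
qed

text \<open>Concavity with \<open>\<phi> 0 = 0\<close> gives
  \<open>\<phi> s \<le> 2 * \<phi> (s / 2)\<close> and positivity away from 0. Decay follows by
  iterating the contraction.\<close>

lemma ex_lorentz_growth:
  assumes mono: "mono_on {0..1} \<phi>" and conc: "concave_on {0..1} \<phi>" and \<phi>0: "\<phi> 0 = 0"
    and ind: "0 < lower_dilation_index \<phi>" and p: "1 \<le> p"
  shows "\<exists>L \<rho>. lorentz_growth (\<lambda>t. \<phi> t powr p) L \<rho> \<phi> p"
proof -
  have nonneg: "0 \<le> \<phi> s" if "0 \<le> s" "s \<le> 1" for s
    using mono_onD[OF mono, of 0 s] that \<phi>0 by simp
  have star: "t * \<phi> s \<le> \<phi> (t * s)" if "0 \<le> t" "t \<le> 1" "0 \<le> s" "s \<le> 1" for s t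
    using concave_onD[OF conc, of t 0 s] that \<phi>0 by simp
  obtain s0 where s0: "s0 \<in> {0<..1}" "\<phi> s0 \<noteq> 0" using ex_nonzero_of_dilation_index[OF mono \<phi>0 ind] by blast
  have "0 < \<phi> s0" using nonneg[of s0] s0 by simp
  also have "\<phi> s0 \<le> \<phi> 1" using s0 by (intro mono_onD[OF mono]) auto
  finally have "0 < \<phi> 1" .
  then have pos: "0 < \<phi> s" if "0 < s" "s \<le> 1" for s
    using star[of s 1] that less_le_trans[OF mult_pos_pos[of s "\<phi> 1"]] by simp
  obtain t q where t: "0 < t" "t < 1" and q: "q < 1" "\<And>s. s \<in> {0<..1} \<Longrightarrow> \<phi> (s * t) \<le> q * \<phi> s"
    using ex_dilation_contraction[OF mono \<phi>0 ind] by blast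
  have q0: "0 < q"
  proof -
    have "0 < q * \<phi> 1" using q(2)[of 1] pos[of t] t by simp
    then show ?thesis using \<open>0 < \<phi> 1\<close> by (simp add: zero_less_mult_iff)
  qed
  have iter: "\<phi> (t ^ n * s) \<le> q ^ n * \<phi> s" if "0 \<le> s" "s \<le> 1" for n s
  proof (induction n)
    case (Suc n)
    show ?case
    proof (cases "s = 0")
      case False
      have "t ^ n * s \<in> {0<..1}" using t that False by (auto simp: power_le_one mult_le_one)
      then have "\<phi> (t ^ Suc n * s) \<le> q * \<phi> (t ^ n * s)" using q(2) by (fastforce simp: mult_ac)
      also have "\<dots> \<le> q * (q ^ n * \<phi> s)" using Suc q0 by simp
      finally show ?thesis by simp
    qed (simp add: \<phi>0)
  qed simp
  \<comment> \<open>One exponent serves both purposes: \<open>q ^ n \<le> 1/2\<close> halves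
    \<open>\<phi>\<close>, and \<open>t ^ n \<le> 1/2\<close> is the bound required of
    \<open>\<rho>\<close>. Halving \<open>\<phi>\<close> at least halves
    \<open>\<phi> powr p\<close>, as \<open>1 \<le> p\<close>.\<close>
  obtain n where n: "max q t ^ n < 1/2"
    using real_arch_pow_inv[of "1/2" "max q t"] q(1) t by auto
  have "q ^ n \<le> max q t ^ n" "t ^ n \<le> max q t ^ n" using q0 t by (auto intro: power_mono)
  then have qt: "q ^ n \<le> 1/2" "t ^ n \<le> 1/2" using n by auto
  have "lorentz_growth (\<lambda>t. \<phi> t powr p) (2 powr p) (t ^ n) \<phi> p"
  proof
    show "\<phi> s powr p \<le> \<phi> u powr p" if "0 \<le> s" "s \<le> u" "u \<le> 1" for s u
      using that p nonneg[of s] by (intro powr_mono2 mono_onD[OF mono]) auto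
    show "\<phi> s powr p \<le> 2 powr p * \<phi> (s / 2) powr p" if "0 \<le> s" "s \<le> 1" for s
    proof -
      have "\<phi> s powr p \<le> (2 * \<phi> (s / 2)) powr p"
        using star[of "1/2" s] that p nonneg[of s] by (intro powr_mono2) auto
      then show ?thesis using that nonneg[of "s / 2"] by (simp add: powr_mult)
    qed
    show "\<phi> (t ^ n * s) powr p \<le> \<phi> s powr p / 2" if s: "0 \<le> s" "s \<le> 1" for s
    proof -
      have ts: "0 \<le> t ^ n * s" "t ^ n * s \<le> 1" using s t by (auto simp: mult_le_one power_le_one)
      have "\<phi> (t ^ n * s) \<le> 1/2 * \<phi> s"
        using iter[OF s, of n] mult_right_mono[OF qt(1) nonneg[OF s]] by linarith
      then have "\<phi> (t ^ n * s) powr p \<le> (1/2 * \<phi> s) powr p"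
        using p nonneg[OF ts] by (intro powr_mono2) auto
      also have "\<dots> = (1/2) powr p * \<phi> s powr p" by (rule powr_mult)
      also have "\<dots> \<le> (1/2) powr 1 * \<phi> s powr p" using p by (intro mult_right_mono powr_mono') auto
      finally show ?thesis by simp
    qed
    show "0 < \<phi> s powr p" if "0 < s" "s \<le> 1" for s using pos[OF that] by simp
  qed (use p \<phi>0 t qt nonneg in auto)
  then show ?thesis by blast
qed

theorem theorem4p3:
  fixes \<phi> w :: "real \<Rightarrow> real" and p :: real
  assumes "mono_on {0..1} \<phi>"
    and "concave_on {0..1} \<phi>"
    and "\<phi> 0 = 0"
    and "lower_dilation_index \<phi> > 0"
    and "1 \<le> p"
    and "nontrivial_weight w"
  shows "w_decomposable w (lorentz_space p \<phi>) (lorentz_norm p \<phi>) \<longleftrightarrow>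
    (\<exists>C>0. \<forall>\<tau> :: nat \<Rightarrow> real. (\<forall>r. 0 < \<tau> r \<and> \<tau> r \<le> weight_seq w r) \<longrightarrow>
       summable (\<lambda>r. \<phi> (\<tau> r) powr p) \<and>
       inverse C * \<phi> (\<Sum>r. \<tau> r) \<le> (\<Sum>r. \<phi> (\<tau> r) powr p) powr (1 / p) \<and>
       (\<Sum>r. \<phi> (\<tau> r) powr p) powr (1 / p) \<le> C * \<phi> (\<Sum>r. \<tau> r))"
proof -
  obtain L \<rho> where "lorentz_growth (\<lambda>t. \<phi> t powr p) L \<rho> \<phi> p"
    using ex_lorentz_growth assms by blast
  then interpret lorentz_growth "\<lambda>t. \<phi> t powr p" L \<rho> \<phi> p .
  define a where "a = (\<lambda>k. measure unit_leb (dyadic_level w k))"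
  have ws: "weight_seq w = family_rearr a" by (simp add: weight_seq_def a_def)
  have w: "w \<in> borel_measurable unit_leb" using assms(6) by (simp add: nontrivial_weight_def weight_def)
  \<comment> \<open>Taking powers preserves inequalities only between nonnegative numbers, so the
    sum has to be placed in the unit interval, where \<open>\<phi>\<close> is nonnegative.\<close>
  have \<phi>\<tau>: "0 \<le> \<phi> (suminf \<tau>)" if \<tau>: "\<forall>r. 0 < \<tau> r \<and> \<tau> r \<le> weight_seq w r" for \<tau>
  proof (rule \<phi>_nonneg)
    have sum_a: "(\<Sum>k\<in>F. a k) \<le> 1" if "finite F" for F
      unfolding a_def by (rule sum_dyadic_level_le_1[OF w that])
    have *: "0 < \<tau> r" "\<tau> r \<le> family_rearr a r" for r using \<tau> by (auto simp: ws)
    show "suminf \<tau> \<le> 1" by (rule suminf_le_family_rearr[of a, OF sum_a *])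
    show "0 \<le> suminf \<tau>"
      using summable_le_family_rearr[of a, OF sum_a *] *(1) by (intro suminf_nonneg) (auto intro: less_imp_le)
  qed
  have conv: "b \<le> D * c \<longleftrightarrow> b powr q \<le> D powr q * c powr q" if "0 \<le> b" "0 \<le> c" "0 < D" "0 < q" for b c D q :: real
    unfolding powr_mult[symmetric]
    using that powr_mono2[of q b "D * c"] powr_less_mono2[of q "D * c" b] by (cases "b \<le> D * c") auto
  have inv: "inverse D * b \<le> c \<longleftrightarrow> b \<le> D * c" if "0 < D" for b c D :: real
    using that by (simp add: field_simps)
  have seq: "(\<exists>K>0. seq_decomposable a K) \<longleftrightarrow>
    (\<exists>C>0. \<forall>\<tau> :: nat \<Rightarrow> real. (\<forall>r. 0 < \<tau> r \<and> \<tau> r \<le> weight_seq w r) \<longrightarrow>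
       summable (\<lambda>r. \<phi> (\<tau> r) powr p) \<and>
       inverse C * \<phi> (\<Sum>r. \<tau> r) \<le> (\<Sum>r. \<phi> (\<tau> r) powr p) powr (1 / p) \<and>
       (\<Sum>r. \<phi> (\<tau> r) powr p) powr (1 / p) \<le> C * \<phi> (\<Sum>r. \<tau> r))" (is "_ \<longleftrightarrow> (\<exists>C>0. ?R C)")
  proof -
    \<comment> \<open>The two forms agree constant by constant; since \<open>C powr p\<close> runs
      through all positive reals, existence of a constant transfers both ways.\<close>
    have iff: "seq_decomposable a (C powr p) \<longleftrightarrow> ?R C" if C: "0 < C" for C
      unfolding seq_decomposable_def ws[symmetric]
    proof (intro all_cong1 imp_cong refl conj_cong)
      fix \<tau> assume \<tau>: "\<forall>r. 0 < \<tau> r \<and> \<tau> r \<le> weight_seq w r" and sm: "summable (\<lambda>r. \<phi> (\<tau> r) powr p)"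
      define u where "u = (\<Sum>r. \<phi> (\<tau> r) powr p)"
      have u: "0 \<le> u" unfolding u_def using sm by (intro suminf_nonneg) auto
      have up: "(u powr (1 / p)) powr p = u" using u p by (simp add: powr_powr)
      show "\<phi> (suminf \<tau>) powr p \<le> C powr p * (\<Sum>r. \<phi> (\<tau> r) powr p) \<longleftrightarrow>
          inverse C * \<phi> (suminf \<tau>) \<le> (\<Sum>r. \<phi> (\<tau> r) powr p) powr (1 / p)"
        unfolding u_def[symmetric] inv[OF C] using conv[of "\<phi> (suminf \<tau>)" "u powr (1 / p)" C p] \<phi>\<tau>[OF \<tau>] C p up
        by simp
      show "(\<Sum>r. \<phi> (\<tau> r) powr p) \<le> C powr p * \<phi> (suminf \<tau>) powr p \<longleftrightarrow>
          (\<Sum>r. \<phi> (\<tau> r) powr p) powr (1 / p) \<le> C * \<phi> (suminf \<tau>)"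
        unfolding u_def[symmetric] using conv[of "u powr (1 / p)" "\<phi> (suminf \<tau>)" C p] \<phi>\<tau>[OF \<tau>] C p up
        by simp
    qed
    show ?thesis
    proof
      assume "\<exists>K>0. seq_decomposable a K"
      then obtain K where K: "0 < K" "seq_decomposable a K" by blast
      have C: "0 < K powr (1 / p)" using K(1) by simp
      have "(K powr (1 / p)) powr p = K" using K(1) p by (simp add: powr_powr)
      then have R: "?R (K powr (1 / p))" using iff[OF C] K(2) by (simp only:)
      show "\<exists>C>0. ?R C" by (rule exI[of _ "K powr (1 / p)"], rule conjI, rule C, rule R)
    next
      assume "\<exists>C>0. ?R C"
      then obtain C where C: "0 < C" "?R C" by (elim exE conjE)
      have "seq_decomposable a (C powr p)" using iff[OF C(1)] C(2) by (rule iffD2)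
      moreover have "0 < C powr p" using C(1) by simp
      ultimately show "\<exists>K>0. seq_decomposable a K" by blast
    qed
  qed
  have dec: "w_decomposable w (lorentz_space p \<phi>) (lorentz_norm p \<phi>) \<longleftrightarrow> (\<exists>K>0. seq_decomposable a K)"
    using seq_decomposable_if_w_decomposable[OF w] w_decomposable_if_seq_decomposable[OF assms(6)]
    unfolding a_def by blast
  show ?thesis by (rule trans[OF dec seq])
qed

end
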